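(* Let $\vec K$ be an oriented knot and let $-\vec K$ be the same knot with reversed orientation. Then the bigraded $\mathcal R$-module $\mathcal J(\vec K)$ satisfies $\mathcal J(\vec K)\cong S(\mathcal J(-\vec K))$ as bigraded $\mathcal R$-modules.
   Context: \textbf{The operation $S$.} For a bigraded $\mathcal R$-module $M=\bigoplus M_{\delta,s}$ ($\delta$ the $\Delta$-grading, $s$ the Alexander grading), $S(M)$ is the bigraded $\mathcal R$-module with the same underlying abelian group, together with a map $\sigma\colon M\to S(M)$ restricting to $\mathbb F$-isomorphisms $M_{\delta,s}\to S(M)_{\delta,-s}$ and satisfying $\sigma(Um)=V\sigma(m)$, $\sigma(Vm)=U\sigma(m)$. The module $\mathcal J(\vec K)$ is $H(\mathcal C(\mathcal D))$, where $\mathcal D$ is any oriented diagram of $\vec K$ in bridge position (it is an invariant of $\vec K$) and $\mathcal C(\mathcal D)$ is the following complex. Let $\mathbb F=\mathbb Z/2\mathbb Z$ and $\mathcal R=\mathbb F[U,V]/(UV)$, bigraded by $(\Delta,A)$ with $U$ in bidegree $(-1,-1)$ and $V$ in bidegree $(-1,+1)$. \textbf{Algebras.} For $0\le k\le m+1$ an I-state is a $k$-element subset $\mathbf x\subset\{0,\dots,m\}$; put $v^{\mathbf x}_i=\#\{x\in\mathbf x: x\ge i\}$ and $w^{\mathbf x,\mathbf y}_i=\frac12|v^{\mathbf x}_i-v^{\mathbf y}_i|$ ($1\le i\le m$). $\mathcal B_0(m,k)$ is the $\mathbb F[U_1,\dots,U_m]$-algebra with idempotents $I_{\mathbf x}$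 such that $I_{\mathbf x}\mathcal B_0I_{\mathbf y}$ is free of rank one over $\mathbb F[U_1,\dots,U_m]$ on $\phi^{\mathbf x,\mathbf y}$, where $U_1^{t_1}\cdots U_m^{t_m}\phi^{\mathbf x,\mathbf y}$ has weight $w=w^{\mathbf x,\mathbf y}+(t_1,\dots,t_m)\in(\frac12\mathbb Z)^m$ and multiplication is the unique nontrivial weight-preserving equivariant one. $R_j=\sum\phi^{\mathbf x,\mathbf y}$ over $j-1\in\mathbf x$, $j\notin\mathbf x$, $\mathbf y=(\mathbf x\setminus\{j-1\})\cup\{j\}$; $L_j=\sum\phi^{\mathbf y,\mathbf x}$ over the same pairs. $\mathcal B(m,k)$ is the quotient of $\mathcal B_0(m,k)$ by the relations $L_{i+1}L_i=0$, $R_iR_{i+1}=0$, and $I_{\mathbf x}U_j=0$ if $\mathbf x\cap\{j-1,j\}=\emptyset$. A pure element is a nonzero image of some $U_1^{t_1}\cdots U_m^{t_m}\phi^{\mathbf x,\mathbf y}$. A matching $M$ on $\{1,\dots,2n\}$ is a partition into pairs. $\mathcal A(n,k,M)$ is the dg algebra obtained from $\mathcal B(2n,k)$ (with $d=0$) by adjoining central elements $C_p$, $p\in M$, with $C_p^2=0$, $dC_{\{i,j\}}=U_iU_j$; $C_{\{i,j\}}$ has weight $e_i+e_j$. \textbf{Type $D$ structures and tensoring.} A type $D$ structure over a dg algebra $\mathcal A$ with idempotent ring $\mathbf I$ is a left $\mathbf I$-module $Y$ with $\delta^1\colon Y\to\mathcal A\otimes_{\mathbf I}Y$ satisfying $(\mu_2\otimes\mathrm{id})(\mathrm{id}\otimes\delta^1)\delta^1+(\mu_1\otimes\mathrm{id})\delta^1=0$;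 $\delta^j\colon Y\to\mathcal A^{\otimes j}\otimes Y$ is the $j$-fold iterate. A type $DA$ bimodule $X$ with input algebra $\mathcal A_1$ and output algebra $\mathcal A_2$ has operations $\delta^1_\ell\colon X\otimes\mathcal A_1^{\otimes(\ell-1)}\to\mathcal A_2\otimes X$, and $X\boxtimes Y=X\otimes_{\mathbf I(\mathcal A_1)}Y$ has $\delta^1=\sum_{j\ge0}(\delta^1_{j+1}\otimes\mathrm{id})(\mathrm{id}\otimes\delta^j)$ (a finite sum here). All type $D$ structures $Y$ below satisfy $\delta^1(\mathbf y)-\sum_pC_p\otimes\mathbf y\in\mathcal B\otimes Y$; so it suffices to give the $\delta^1_\ell$ on sequences each of whose entries is a pure element of $\mathcal B$ or some $C_p$. Below, operations on such sequences that are not listed are zero. \textbf{Crossings.} Let $\tau_i$ be the transposition of $i,i+1$. $\mathcal P^i$ has input $\mathcal A(n,k,M)$, output $\mathcal A(n,k,\tau_i(M))$, and generators of types $\mathbf N,\mathbf S,\mathbf W,\mathbf E$ with (left, right) idempotents: $\mathbf N$: $(\mathbf x,\mathbf x)$, $i\in\mathbf x$; $\mathbf S$: $(\mathbf x,\mathbf x)$, $i\notin\mathbf x$; $\mathbf W$: $(\mathbf x,(\mathbf x\setminus\{i\})\cup\{i-1\})$, $i\in\mathbf x$, $i-1\notin\mathbf x$; $\mathbf E$: $(\mathbf x,(\mathbf x\setminus\{i\})\cup\{i+1\})$, $i\in\mathbf x$, $i+1\notin\mathbf x$. Put $\mathrm{gr}(\mathbf N)=\frac{e_i+e_{i+1}}4$,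 $\mathrm{gr}(\mathbf W)=\frac{e_i-e_{i+1}}4$, $\mathrm{gr}(\mathbf E)=\frac{-e_i+e_{i+1}}4$, $\mathrm{gr}(\mathbf S)=\frac{-e_i-e_{i+1}}4$. The local operations are the following, written in formal expressions $U_1^aU_2^be$, $e\in\{1,L_1,R_1,L_2,R_2,L_1L_2,R_2R_1\}$; $(X,a,\dots)\to b\otimes Y$ means that $b\otimes Y$ appears with coefficient 1. $\delta^1_1$: $\mathbf W\to L_1\otimes\mathbf S$, $\mathbf E\to R_2\otimes\mathbf S$. $\delta^1_2$: $(X,1)\to1\otimes X$ for all $X$; $(\mathbf N,L_1L_2)\to L_1L_2\otimes\mathbf N$; $(\mathbf N,R_2R_1)\to R_2R_1\otimes\mathbf N$; $(\mathbf N,L_1)\to U_2\otimes\mathbf W$ and $\to L_1L_2\otimes\mathbf E$; $(\mathbf N,R_2)\to R_2R_1\otimes\mathbf W$ and $\to U_1\otimes\mathbf E$; $(\mathbf W,R_1)\to1\otimes\mathbf N$; $(\mathbf W,L_2U_1)\to L_1L_2\otimes\mathbf N$; $(\mathbf E,L_2)\to1\otimes\mathbf N$; $(\mathbf E,R_1U_2)\to R_2R_1\otimes\mathbf N$; $(\mathbf W,U_1)\to L_1L_2\otimes\mathbf E$; $(\mathbf E,U_2)\to R_2R_1\otimes\mathbf W$; closed under: if $(X,a)\to b\otimes Y$ then $(X,U_1U_2a)\to U_1U_2b\otimes Y$; if moreover $X=\mathbf N$ then $(\mathbf N,U_1a)\to U_2b\otimes Y$ and $(\mathbf N,U_2a)\to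 U_1b\otimes Y$; if $X=\mathbf W$ then $(\mathbf W,U_1a)\to U_2b\otimes Y$; if $X=\mathbf E$ then $(\mathbf E,U_2a)\to U_1b\otimes Y$. $\delta^1_3(\mathbf S,a_1,a_2)$, for $U_1U_2$ dividing neither $a_1$ nor $a_2$, is the sum of: $R_1U_1^t\otimes\mathbf E$ if $(a_1,a_2)=(R_1,R_2U_2^t)$, $t\ge0$; $L_2U_2^n\otimes\mathbf W$ if $(a_1,a_2)=(L_2,L_1U_1^n)$, $n\ge0$; $L_2U_1^tU_2^n\otimes\mathbf E$ if $(a_1,a_2)\in\{(U_1^{n+1},U_2^t),(R_1U_1^n,L_1U_2^t),(L_2U_1^{n+1},R_2U_2^{t-1})\}$, $0\le n<t$, or $\in\{(U_2^t,U_1^{n+1}),(R_1U_2^t,L_1U_1^n),(L_2U_2^{t-1},R_2U_1^{n+1})\}$, $1\le t\le n$; $R_1U_1^tU_2^n\otimes\mathbf W$ if $(a_1,a_2)\in\{(U_2^{t+1},U_1^n),(L_2U_2^t,R_2U_1^n),(R_1U_2^{t+1},L_1U_1^{n-1})\}$, $0\le t<n$, or $\in\{(U_1^n,U_2^{t+1}),(L_2U_1^n,R_2U_2^t),(R_1U_1^{n-1},L_1U_2^{t+1})\}$, $1\le n\le t$; $L_2U_1^tU_2^n\otimes\mathbf N$ if $(a_1,a_2)\in\{(U_1^{n+1},L_2U_2^t),(R_1U_1^n,L_1L_2U_2^t),(L_2U_1^{n+1},U_2^t)\}$, $0\le n<t$, or $\in\{(L_2U_2^t,U_1^{n+1}),(U_2^t,L_2U_1^{n+1}),(R_1U_2^t,L_1L_2U_1^n)\}$,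 $1\le t\le n$, or $=(L_2,U_1^{n+1})$, $0=t\le n$; $R_1U_1^tU_2^n\otimes\mathbf N$ if $(a_1,a_2)\in\{(U_2^{t+1},R_1U_1^n),(L_2U_2^t,R_2R_1U_1^n),(R_1U_2^{t+1},U_1^n)\}$, $0\le t<n$, or $\in\{(R_1U_1^n,U_2^{t+1}),(U_1^n,R_1U_2^{t+1}),(L_2U_1^n,R_2R_1U_2^t)\}$, $1\le n\le t$, or $=(R_1,U_2^{t+1})$, $0=n\le t$; and $\delta^1_3$ commutes with multiplying either input by $U_1U_2$ (output multiplied by $U_1U_2$). For pure $a\in I_{\mathbf x}\mathcal B(2n,k)I_{\mathbf y}$ let $t(a)=U_1^{\lfloor w_i(a)\rfloor}U_2^{\lfloor w_{i+1}(a)\rfloor}e$, where $e=1$ if $w_i(a),w_{i+1}(a)\in\mathbb Z$; $e=R_1$ (resp. $L_1$) if only $w_i(a)\notin\mathbb Z$ and $v^{\mathbf x}_i<v^{\mathbf y}_i$ (resp. $>$); $e=R_2$ (resp. $L_2$) if only $w_{i+1}(a)\notin\mathbb Z$ and $v^{\mathbf x}_{i+1}<v^{\mathbf y}_{i+1}$ (resp. $>$); $e=R_2R_1$ (resp. $L_1L_2$) if neither is an integer and $v^{\mathbf x}_{i+1}<v^{\mathbf y}_{i+1}$ (resp. $>$). For pure, idempotent-composable $a_1,\dots,a_{\ell-1}\in\mathcal B(2n,k)$, $\delta^1_\ell(X,a_1,\dots,a_{\ell-1})$ is the sum of all $b\otimes Y$ with $b$ pure, $Y$ a generator, idempotents matching,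 $\mathrm{gr}(X)+\tau_i(\sum_jw(a_j))=w(b)+\mathrm{gr}(Y)$ ($\tau_i$ permuting coordinates), such that $t(b)\otimes\mathrm{type}(Y)$ appears in the local operation on $(\mathrm{type}(X),t(a_1),\dots,t(a_{\ell-1}))$. Finally $\delta^1_2(X,C_p)=C_{\tau_i(p)}\otimes X$, plus, when $\{i,i+1\}\notin M$, $\{i,\alpha\},\{i+1,\beta\}\in M$ and $X$ is of type $\mathbf S$: the term $U_\alpha L_{i+1}\otimes\mathbf E$ if $p=\{i,\alpha\}$ and $U_\beta R_i\otimes\mathbf W$ if $p=\{i+1,\beta\}$ (generators determined by idempotents). $\mathcal N^i$ (same input and output algebras) is the opposite: it has dual generators $\overline X$, with the same idempotents and types, and $o(b)\otimes\overline X$ appears in $\delta^1_\ell(\overline Y,o(a_{\ell-1}),\dots,o(a_1))$ for $\mathcal N^i$ iff $b\otimes Y$ appears in $\delta^1_\ell(X,a_1,\dots,a_{\ell-1})$ for $\mathcal P^i$, where $o$ is the anti-automorphism fixing all $I_{\mathbf x},U_j,C_p$ and exchanging $L_j\leftrightarrow R_j$. \textbf{Maximum.} Let $\phi_c(j)=j$ for $j<c$ and $\phi_c(j)=j+2$ for $j\ge c$. $\Omega^c$ ($1\le c\le2n+1$) has input $\mathcal A(n,k,M)$ and output $\mathcal A(n+1,k+1,\phi_c(M)\cup\{\{c,c+1\}\})$. Generators $\mathbf Q_{\mathbf y}$: I-states $\mathbf y$ of the output algebra with $c\in\mathbf y$ and $|\mathbf y\cap\{c-1,c+1\}|\le1$;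 left idempotent $I_{\mathbf y}$, right idempotent $I_{\psi(\mathbf y)}$, where $\psi(\mathbf y)=\phi_c^{-1}(\mathbf y)$ if $c+1\notin\mathbf y$ and $\phi_c^{-1}(\mathbf y)\cup\{c-1\}$ if $c+1\in\mathbf y$. $\delta^1_1(\mathbf Q_{\mathbf y})=I_{\mathbf y}(R_{c+1}R_c+L_cL_{c+1}+C_{\{c,c+1\}})\otimes\sum_{\mathbf z}\mathbf Q_{\mathbf z}$. For pure $a\in I_{\psi(\mathbf y)}\mathcal B(2n,k)I_{\mathbf x'}$, $\delta^1_2(\mathbf Q_{\mathbf y},a)=b\otimes\mathbf Q_{\mathbf z}$ where $\psi(\mathbf z)=\mathbf x'$ and $b\in I_{\mathbf y}\mathcal B(2n+2,k+1)I_{\mathbf z}$ is pure with $w_{\phi_c(j)}(b)=w_j(a)$, $w_c(b)=w_{c+1}(b)=0$ (zero if there is none; there is at most one). $\delta^1_2(\mathbf Q_{\mathbf y},C_p)=C_{\phi_c(p)}\otimes\mathbf Q_{\mathbf y}$. \textbf{Minimum.} Let $M_1$ be a matching on $\{1,\dots,2n+2\}$ with $\{c,\phi_c(\alpha)\},\{c+1,\phi_c(\beta)\}\in M_1$, and $M_2=\{\{\alpha,\beta\}\}\cup\{\{i,j\}:\{\phi_c(i),\phi_c(j)\}\in M_1\}$. $\mho^c$ has input $\mathcal A(n+1,k+1,M_1)$ and output $\mathcal A(n,k,M_2)$. For $c=1$: generators $\mathbf T_{\mathbf x}$, $\mathbf x=\{x_1<\dots<x_{k+1}\}$ with $\mathbf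 x\cap\{0,1,2\}\in\{\{0\},\{2\},\{0,2\}\}$, right idempotent $I_{\mathbf x}$, left idempotent $I_{\psi(\mathbf x)}$, $\psi(\mathbf x)=\{0,x_3-2,\dots,x_{k+1}-2\}$ if $|\mathbf x\cap\{0,1,2\}|=2$ and $\{x_2-2,\dots,x_{k+1}-2\}$ if it is 1. Write $C_1=C_{\{1,\alpha+2\}}$, $C_2=C_{\{2,\beta+2\}}$. Operations: $\delta^1_2(\mathbf T_{\mathbf x},C_{\{i+2,j+2\}})=C_{\{i,j\}}\otimes\mathbf T_{\mathbf x}$ for $\{i,j\}\in M_2\setminus\{\{\alpha,\beta\}\}$; $\delta^1_3(\mathbf T_{\mathbf x},C_1,C_2)=C_{\{\alpha,\beta\}}\otimes\mathbf T_{\mathbf x}$ if $0\in\mathbf x$; $\delta^1_3(\mathbf T_{\mathbf x},C_2,C_1)=C_{\{\alpha,\beta\}}\otimes\mathbf T_{\mathbf x}$ if $0\notin\mathbf x$; and the following. Consider the graph with vertices $XL_1,YR_2,X,Y$ and, for each $m\ge0$, edges labelled: $XL_1\to XL_1$: $U_1^m\otimes C_2^{\otimes m}$; $XL_1\to Y$: $U_1^mR_1\otimes C_2^{\otimes m}$; $X\to XL_1$: $U_1^mL_1\otimes C_2^{\otimes m}$; $X\to Y$: $U_1^{m+1}\otimes C_2^{\otimes m}$; $Y\to X$: $U_2^{m+1}\otimes C_1^{\otimes m}$; $Y\to YR_2$: $U_2^mR_2\otimes C_1^{\otimes m}$; $YR_2\to YR_2$: $U_2^m\otimes C_1^{\otimes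 m}$; $YR_2\to X$: $U_2^mL_2\otimes C_1^{\otimes m}$. Take a path from $XL_1$ (if $0\in\mathbf x$) or $YR_2$ (if $0\notin\mathbf x$) ending at $XL_1$ or $YR_2$ with no interior vertex at $XL_1$ or $YR_2$. For any idempotent-composable sequence $a_1,\dots,a_m$, starting at $I_{\mathbf x}$ and ending at $I_{\mathbf y}$ with $\mathbf x\cap\{0,1,2\}$ and $\mathbf y\cap\{0,1,2\}$ both in $\{\{0\},\{2\},\{0,2\}\}$, obtained by listing for each edge in turn a pure element of $\mathcal B(2n+2,k+1)$ whose weights $w_1,w_2$ are those of the $\mathcal B$-part of the label, followed by the listed copies of $C_1$ or $C_2$, set $\delta^1_{m+1}(\mathbf T_{\mathbf x},a_1,\dots,a_m)=b\otimes\mathbf T_{\mathbf y}$, with $b=I_{\psi(\mathbf x)}b$ the pure element of $\mathcal B(2n,k)$ with $w_i(b)=\sum_jw_{i+2}(a_j)$ for all $i$ (zero if there is none). For $c>1$ inductively $\mho^c=\mho^{c-1}\boxtimes\mathcal P^c\boxtimes\mathcal P^{c-1}$ (apply $\mathcal P^{c-1}$ first). \textbf{The complex.} $\mathcal D$ is in bridge position if critical points of the height $y$ are nondegenerate, all maxima, minima and crossings have distinct heights, and the marked point is the unique global minimum. A generic level meets $\mathcal D$ in $2n$ points, numbered left to right and matched when joined by an arc of $\mathcal D$ above the level; the associated algebra is $\mathcal A(n,n,M)$. Begin above $\mathcal D$ with the type $D$ structure $\mathbb F$ with $\delta^1=0$ over $\mathcal A(0,0,\emptyset)=\mathbb F$,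 move down, and tensor successively with $\Omega^c$ (maximum creating strands $c,c+1$), $\mho^c$ (minimum joining strands $c,c+1$), and $\mathcal P^i$ or $\mathcal N^i$ (crossing of strands $i,i+1$ which is positive, resp. negative, when both strands are oriented upwards). Stop just above the global minimum. The result is a type $D$ structure over $\mathcal A(1,1,\{\{1,2\}\})$ all of whose generators lie in the idempotent $I_{\{1\}}$, and $I_{\{1\}}\mathcal A(1,1,\{\{1,2\}\})I_{\{1\}}=\mathbb F[U_1,U_2,C]/(U_1U_2,C^2)$. $\mathcal C(\mathcal D)$ is the free $\mathcal R$-module on its generators, with differential obtained from $\delta^1$ by setting $C\mapsto0$ and $U_1\mapsto U,\ U_2\mapsto V$ if strand 1 is oriented upwards there, $U_1\mapsto V,\ U_2\mapsto U$ otherwise. \textbf{Gradings.} A generator determines a type $\mathbf N,\mathbf S,\mathbf W,\mathbf E$ at each crossing, i.e. one of its four quadrants. At a crossing of sign $\varepsilon=\pm1$ the quadrant between the two outgoing edges contributes $A=-\varepsilon/2$, $\Delta=-\varepsilon/2$; the quadrant between the two incoming edges contributes $A=+\varepsilon/2$, $\Delta=-\varepsilon/2$; the other two contribute $0$. The gradings $A,\Delta$ of a generator are the sums over all crossings. The differential has bidegree $(\Delta,A)=(-1,0)$. *)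

theory Defs
  imports "HOL-Analysis.Analysis" "HOL-Algebra.QuotRing" "HOL-Algebra.Module"
    "HOL-Library.Poly_Mapping" "HOL-Library.Z2"
begin

section \<open>Bigraded modules over \<open>\<F>[U,V]/(UV)\<close>\<close>

text \<open>
  \<open>\<F>[U,V]\<close> is the monoid algebra of \<open>\<nat> \<times> \<nat>\<close> over \<^typ>\<open>bit\<close>; the key
  \<open>(a, b)\<close> stands for the monomial \<open>U\<^sup>a V\<^sup>b\<close>.
\<close>

type_synonym fuv = "(nat \<times> nat) \<Rightarrow>\<^sub>0 bit"

definition FUV :: "fuv ring" where
  "FUV = \<lparr>carrier = UNIV, mult = (*), one = 1, zero = 0, add = (+)\<rparr>"

definition UV_ideal :: "fuv set" where
  "UV_ideal = genideal FUV {Poly_Mapping.single (1, 1) 1}"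

definition RUV :: "fuv set ring" where
  "RUV = FUV Quot UV_ideal"

definition R_monom :: "nat \<Rightarrow> nat \<Rightarrow> fuv set" where
  "R_monom a b = UV_ideal +>\<^bsub>FUV\<^esub> Poly_Mapping.single (a, b) 1"

text \<open>The first index is the \<open>\<Delta>\<close>-degree, the second the Alexander degree;
  \<open>U\<close> has bidegree \<open>(-1, -1)\<close> and \<open>V\<close> has bidegree \<open>(-1, 1)\<close>.\<close>

definition R_comp :: "rat \<Rightarrow> rat \<Rightarrow> fuv set set" where
  "R_comp d s = {UV_ideal +>\<^bsub>FUV\<^esub> p | p.
     \<forall>(a, b) \<in> Poly_Mapping.keys p. - of_nat a - of_nat b = d \<and> of_nat b - of_nat a = s}"

definition R_swap :: "fuv set \<Rightarrow> fuv set" where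
  "R_swap X = Poly_Mapping.map_key prod.swap ` X"

text \<open>The fields \<^const>\<open>mult\<close> and \<^const>\<open>one\<close> that modules inherit from rings are
  not used.\<close>

record 'b bigraded = "(fuv set, 'b) module" +
  comp :: "rat \<Rightarrow> rat \<Rightarrow> 'b set"

definition bigraded_iso :: "'b bigraded \<Rightarrow> 'c bigraded \<Rightarrow> bool"  (infix \<open>\<cong>\<^sub>b\<close> 50) where
  "M \<cong>\<^sub>b N \<longleftrightarrow> (\<exists>f \<in> iso (add_monoid M) (add_monoid N).
     (\<forall>r \<in> carrier RUV. \<forall>x \<in> carrier M. f (r \<odot>\<^bsub>M\<^esub> x) = r \<odot>\<^bsub>N\<^esub> f x) \<and>
     (\<forall>d s. f ` comp M d s = comp N d s))"

text \<open>The operation \<open>S\<close>, with \<open>\<sigma>\<close> the identity on underlying sets.\<close>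

definition S_op :: "'b bigraded \<Rightarrow> 'b bigraded" where
  "S_op M = M\<lparr>smult := (\<lambda>r x. R_swap r \<odot>\<^bsub>M\<^esub> x), comp := (\<lambda>d s. comp M d (- s))\<rparr>"

definition homology :: "'b bigraded \<Rightarrow> ('b \<Rightarrow> 'b) \<Rightarrow> 'b set bigraded" where
  "homology C df =
    (let Z = {z \<in> carrier C. df z = \<zero>\<^bsub>C\<^esub>}; B = df ` carrier C in
     \<lparr>carrier = {B +>\<^bsub>C\<^esub> z | z. z \<in> Z},
      mult = undefined, one = undefined,
      zero = B,
      add = (\<lambda>X Y. X <+>\<^bsub>C\<^esub> Y),
      smult = (\<lambda>r X. \<Union>x\<in>X. B +>\<^bsub>C\<^esub> (r \<odot>\<^bsub>C\<^esub> x)),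
      comp = (\<lambda>d s. {B +>\<^bsub>C\<^esub> z | z. z \<in> Z \<inter> comp C d s})\<rparr>)"

definition free_bigraded ::
  "'g set \<Rightarrow> ('g \<Rightarrow> rat) \<Rightarrow> ('g \<Rightarrow> rat) \<Rightarrow> ('g \<Rightarrow> fuv set) bigraded" where
  "free_bigraded G gr\<Delta> grA =
    \<lparr>carrier = G \<rightarrow>\<^sub>E carrier RUV,
     mult = undefined, one = undefined,
     zero = (\<lambda>g\<in>G. \<zero>\<^bsub>RUV\<^esub>),
     add = (\<lambda>f h. \<lambda>g\<in>G. f g \<oplus>\<^bsub>RUV\<^esub> h g),
     smult = (\<lambda>r f. \<lambda>g\<in>G. r \<otimes>\<^bsub>RUV\<^esub> f g),
     comp = (\<lambda>d s. {f \<in> G \<rightarrow>\<^sub>E carrier RUV. \<forall>g\<in>G. f g \<in> R_comp (d - gr\<Delta> g) (s - grA g)})\<rparr>"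


section \<open>The algebras\<close>

definition I_state :: "nat \<Rightarrow> nat \<Rightarrow> nat set \<Rightarrow> bool" where
  "I_state m k x \<longleftrightarrow> x \<subseteq> {0..m} \<and> card x = k"

definition vcount :: "nat set \<Rightarrow> nat \<Rightarrow> nat" where
  "vcount x i = card {j \<in> x. i \<le> j}"

definition wphi :: "nat set \<Rightarrow> nat set \<Rightarrow> nat \<Rightarrow> rat" where
  "wphi x y i = \<bar>of_nat (vcount x i) - of_nat (vcount y i)\<bar> / 2"

text \<open>\<open>Phi x t y\<close> is \<open>U\<^sub>1\<^bsup>t 1\<^esup> \<cdots> U\<^sub>m\<^bsup>t m\<^esup> \<phi>\<^bsup>x,y\<^esup>\<close>.
  Its weight vanishes outside \<open>{1..m}\<close> when \<open>x\<close>, \<open>y\<close> are I-states of the same size and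
  \<open>t\<close> is supported in \<open>{1..m}\<close>, as is required in \<open>pure0\<close>.\<close>

datatype pure = Phi (src: "nat set") (expo: "nat \<Rightarrow> nat") (tgt: "nat set")

definition wt :: "pure \<Rightarrow> nat \<Rightarrow> rat" where
  "wt p i = wphi (src p) (tgt p) i + of_nat (expo p i)"

definition pure0 :: "nat \<Rightarrow> nat \<Rightarrow> pure \<Rightarrow> bool" where
  "pure0 m k p \<longleftrightarrow> I_state m k (src p) \<and> I_state m k (tgt p) \<and> (\<forall>i. i \<notin> {1..m} \<longrightarrow> expo p i = 0)"

text \<open>The weight-preserving product of \<open>p\<close> and \<open>q\<close>, for \<open>tgt p = src q\<close>.\<close>

definition mult0 :: "pure \<Rightarrow> pure \<Rightarrow> pure"  (infixl \<open>\<bullet>\<^sub>0\<close> 70) where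
  "p \<bullet>\<^sub>0 q = Phi (src p) (\<lambda>i. nat \<lfloor>wt p i + wt q i - wphi (src p) (tgt q) i\<rfloor>) (tgt q)"

text \<open>The summands \<open>\<phi>\<^bsup>x,y\<^esup>\<close> of \<open>R\<^sub>j\<close> and \<open>\<phi>\<^bsup>y,x\<^esup>\<close> of \<open>L\<^sub>j\<close>.\<close>

definition R_terms :: "nat \<Rightarrow> nat \<Rightarrow> nat \<Rightarrow> pure set" where
  "R_terms m k j = {Phi x (\<lambda>_. 0) y | x y. I_state m k x \<and> 1 \<le> j \<and> j \<le> m \<and>
     j - 1 \<in> x \<and> j \<notin> x \<and> y = insert j (x - {j - 1})}"

definition L_terms :: "nat \<Rightarrow> nat \<Rightarrow> nat \<Rightarrow> pure set" where
  "L_terms m k j = {Phi y (\<lambda>_. 0) x | x y. Phi x (\<lambda>_. 0) y \<in> R_terms m k j}"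

text \<open>The homogeneous pieces (with respect to the idempotents) of the relations imposed on
  \<open>\<B>\<^sub>0(m,k)\<close>.  Each of them is a single pure element, so the ideal they generate is spanned
  by pure elements, and \<open>\<B>(m,k)\<close> has the pure elements outside this ideal as a basis.\<close>

definition B_relation :: "nat \<Rightarrow> nat \<Rightarrow> pure \<Rightarrow> bool" where
  "B_relation m k r \<longleftrightarrow>
     (\<exists>i p q. p \<in> L_terms m k (i + 1) \<and> q \<in> L_terms m k i \<and> tgt p = src q \<and> r = p \<bullet>\<^sub>0 q) \<or>
     (\<exists>i p q. p \<in> R_terms m k i \<and> q \<in> R_terms m k (i + 1) \<and> tgt p = src q \<and> r = p \<bullet>\<^sub>0 q) \<or>
     (\<exists>x j. I_state m k x \<and> 1 \<le> j \<and> j \<le> m \<and> x \<inter> {j - 1, j} = {} \<and>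
        r = Phi x (\<lambda>i. if i = j then 1 else 0) x)"

definition B_zero :: "nat \<Rightarrow> nat \<Rightarrow> pure \<Rightarrow> bool" where
  "B_zero m k p \<longleftrightarrow> (\<exists>a r b. pure0 m k a \<and> B_relation m k r \<and> pure0 m k b \<and>
     tgt a = src r \<and> tgt r = src b \<and> p = a \<bullet>\<^sub>0 r \<bullet>\<^sub>0 b)"

definition B_pure :: "nat \<Rightarrow> nat \<Rightarrow> pure \<Rightarrow> bool" where
  "B_pure m k p \<longleftrightarrow> pure0 m k p \<and> \<not> B_zero m k p"

text \<open>The basis elements of \<open>\<A>(n,k,M)\<close> that occur in the operations: pure elements of
  \<open>\<B>(2n,k)\<close>, and \<open>Cel x p\<close>, which is \<open>I\<^sub>x C\<^sub>p\<close>.  Products of several \<open>C\<^sub>p\<close> never occur in a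
  differential \<open>\<delta>\<^sup>1\<close>, and the product and differential of \<open>\<A>(n,k,M)\<close> enter only the type D
  structure equation, not the construction of the complex.\<close>

datatype alg = Bel pure | Cel "nat set" "nat set"

fun lidem :: "alg \<Rightarrow> nat set" where
  "lidem (Bel p) = src p"
| "lidem (Cel x p) = x"

fun ridem :: "alg \<Rightarrow> nat set" where
  "ridem (Bel p) = tgt p"
| "ridem (Cel x p) = x"

fun alg_wt :: "alg \<Rightarrow> nat \<Rightarrow> rat" where
  "alg_wt (Bel p) i = wt p i"
| "alg_wt (Cel x p) i = (if i \<in> p then 1 else 0)"

fun opp :: "alg \<Rightarrow> alg" where
  "opp (Bel p) = Bel (Phi (tgt p) (expo p) (src p))"
| "opp (Cel x p) = Cel x p"

fun composable :: "nat set \<Rightarrow> alg list \<Rightarrow> nat set \<Rightarrow> bool" where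
  "composable x [] y \<longleftrightarrow> x = y"
| "composable x (a # as) y \<longleftrightarrow> lidem a = x \<and> composable (ridem a) as y"


section \<open>Type D structures and box tensor products\<close>

datatype gtype = North | South | West | East | Qtype | Ttype

text \<open>A generator of a type DA bimodule, with its left (output) and right (input) idempotent.\<close>

datatype dagen = Gen (kind: gtype) (lid: "nat set") (rid: "nat set")

text \<open>A generator of an iterated tensor product is the list of its tensor factors, the factor
  of the lowest piece of the diagram first.\<close>

fun gidem :: "dagen list \<Rightarrow> nat set" where
  "gidem [] = {}"
| "gidem (X # y) = lid X"

text \<open>\<open>dcoef Y y a z\<close>: the term \<open>a \<otimes> z\<close> has coefficient 1 in \<open>\<delta>\<^sup>1(y)\<close>.\<close>

record typeD =
  dgens :: "dagen list set"
  dcoef :: "dagen list \<Rightarrow> alg \<Rightarrow> dagen list \<Rightarrow> bool"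

text \<open>The terms of the iterate \<open>\<delta>\<^sup>j(y)\<close> before collecting: \<open>p\<close> records the successive
  algebra outputs and intermediate generators.\<close>

fun dpath :: "typeD \<Rightarrow> dagen list \<Rightarrow> (alg \<times> dagen list) list \<Rightarrow> dagen list \<Rightarrow> bool" where
  "dpath Y y [] y' \<longleftrightarrow> y = y'"
| "dpath Y y ((a, z) # p) y' \<longleftrightarrow> dcoef Y y a z \<and> dpath Y z p y'"

text \<open>\<open>op X as b X'\<close>: the term \<open>b \<otimes> X'\<close> has coefficient 1 in \<open>\<delta>\<^sup>1\<^bsub>1 + length as\<^esub>(X, as)\<close>.\<close>

type_synonym da_op = "dagen \<Rightarrow> alg list \<Rightarrow> alg \<Rightarrow> dagen \<Rightarrow> bool"

definition box :: "dagen set \<Rightarrow> da_op \<Rightarrow> typeD \<Rightarrow> typeD" where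
  "box G op Y =
    (let H = {X # y | X y. X \<in> G \<and> y \<in> dgens Y \<and> rid X = gidem y} in
     \<lparr>dgens = H,
      dcoef = (\<lambda>g b g'. g \<in> H \<and> g' \<in> H \<and>
        odd (card {p. dpath Y (tl g) p (tl g') \<and> op (hd g) (map fst p) b (hd g')}))\<rparr>)"


section \<open>Crossings\<close>

definition tau :: "nat \<Rightarrow> nat \<Rightarrow> nat" where
  "tau i j = (if j = i then i + 1 else if j = i + 1 then i else j)"

definition cross_gens :: "nat \<Rightarrow> nat \<Rightarrow> nat \<Rightarrow> dagen set" where
  "cross_gens m k i =
     {Gen North x x | x. I_state m k x \<and> i \<in> x} \<union>
     {Gen South x x | x. I_state m k x \<and> i \<notin> x} \<union>
     {Gen West x (insert (i - 1) (x - {i})) | x. I_state m k x \<and> i \<in> x \<and> i - 1 \<notin> x} \<union>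
     {Gen East x (insert (i + 1) (x - {i})) | x. I_state m k x \<and> i \<in> x \<and> i + 1 \<notin> x}"

fun cross_gr :: "nat \<Rightarrow> gtype \<Rightarrow> nat \<Rightarrow> rat" where
  "cross_gr i X j =
     (if j = i then (if X \<in> {North, West} then 1/4 else - 1/4)
      else if j = i + 1 then (if X \<in> {North, East} then 1/4 else - 1/4)
      else 0)"

text \<open>The triple \<open>(a, b, e)\<close> is the formal expression \<open>U\<^sub>1\<^sup>a U\<^sub>2\<^sup>b e\<close>.\<close>

datatype lsym = e1 | eL1 | eR1 | eL2 | eR2 | eL1L2 | eR2R1

type_synonym lexpr = "nat \<times> nat \<times> lsym"

fun times_U1 :: "lexpr \<Rightarrow> lexpr" where "times_U1 (a, b, e) = (a + 1, b, e)"
fun times_U2 :: "lexpr \<Rightarrow> lexpr" where "times_U2 (a, b, e) = (a, b + 1, e)"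
definition times_UU :: "lexpr \<Rightarrow> lexpr" where "times_UU a = times_U1 (times_U2 a)"

inductive loc1 :: "gtype \<Rightarrow> lexpr \<Rightarrow> gtype \<Rightarrow> bool" where
  "loc1 West (0, 0, eL1) South"
| "loc1 East (0, 0, eR2) South"

inductive loc2 :: "gtype \<Rightarrow> lexpr \<Rightarrow> lexpr \<Rightarrow> gtype \<Rightarrow> bool" where
  "X \<in> {North, South, West, East} \<Longrightarrow> loc2 X (0, 0, e1) (0, 0, e1) X"
| "loc2 North (0, 0, eL1L2) (0, 0, eL1L2) North"
| "loc2 North (0, 0, eR2R1) (0, 0, eR2R1) North"
| "loc2 North (0, 0, eL1) (0, 1, e1) West"
| "loc2 North (0, 0, eL1) (0, 0, eL1L2) East"
| "loc2 North (0, 0, eR2) (0, 0, eR2R1) West"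
| "loc2 North (0, 0, eR2) (1, 0, e1) East"
| "loc2 West (0, 0, eR1) (0, 0, e1) North"
| "loc2 West (1, 0, eL2) (0, 0, eL1L2) North"
| "loc2 East (0, 0, eL2) (0, 0, e1) North"
| "loc2 East (0, 1, eR1) (0, 0, eR2R1) North"
| "loc2 West (1, 0, e1) (0, 0, eL1L2) East"
| "loc2 East (0, 1, e1) (0, 0, eR2R1) West"
| "loc2 X a b Y \<Longrightarrow> loc2 X (times_UU a) (times_UU b) Y"
| "loc2 North a b Y \<Longrightarrow> loc2 North (times_U1 a) (times_U2 b) Y"
| "loc2 North a b Y \<Longrightarrow> loc2 North (times_U2 a) (times_U1 b) Y"
| "loc2 West a b Y \<Longrightarrow> loc2 West (times_U1 a) (times_U2 b) Y"
| "loc2 East a b Y \<Longrightarrow> loc2 East (times_U2 a) (times_U1 b) Y"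

text \<open>\<open>loc3 a\<^sub>1 a\<^sub>2 b Y\<close>: the term \<open>b \<otimes> Y\<close> appears in \<open>\<delta>\<^sup>1\<^sub>3(S, a\<^sub>1, a\<^sub>2)\<close>.\<close>

inductive loc3 :: "lexpr \<Rightarrow> lexpr \<Rightarrow> lexpr \<Rightarrow> gtype \<Rightarrow> bool" where
  "loc3 (0, 0, eR1) (0, t, eR2) (t, 0, eR1) East"

| "loc3 (0, 0, eL2) (n, 0, eL1) (0, n, eL2) West"

| "n < t \<Longrightarrow> (a1, a2) \<in> {((n + 1, 0, e1), (0, t, e1)), ((n, 0, eR1), (0, t, eL1)),
     ((n + 1, 0, eL2), (0, t - 1, eR2))} \<Longrightarrow> loc3 a1 a2 (t, n, eL2) East"
| "1 \<le> t \<Longrightarrow> t \<le> n \<Longrightarrow> (a1, a2) \<in> {((0, t, e1), (n + 1, 0, e1)), ((0, t, eR1), (n, 0, eL1)),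
     ((0, t - 1, eL2), (n + 1, 0, eR2))} \<Longrightarrow> loc3 a1 a2 (t, n, eL2) East"

| "t < n \<Longrightarrow> (a1, a2) \<in> {((0, t + 1, e1), (n, 0, e1)), ((0, t, eL2), (n, 0, eR2)),
     ((0, t + 1, eR1), (n - 1, 0, eL1))} \<Longrightarrow> loc3 a1 a2 (t, n, eR1) West"
| "1 \<le> n \<Longrightarrow> n \<le> t \<Longrightarrow> (a1, a2) \<in> {((n, 0, e1), (0, t + 1, e1)), ((n, 0, eL2), (0, t, eR2)),
     ((n - 1, 0, eR1), (0, t + 1, eL1))} \<Longrightarrow> loc3 a1 a2 (t, n, eR1) West"

| "n < t \<Longrightarrow> (a1, a2) \<in> {((n + 1, 0, e1), (0, t, eL2)), ((n, 0, eR1), (0, t, eL1L2)),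
     ((n + 1, 0, eL2), (0, t, e1))} \<Longrightarrow> loc3 a1 a2 (t, n, eL2) North"
| "1 \<le> t \<Longrightarrow> t \<le> n \<Longrightarrow> (a1, a2) \<in> {((0, t, eL2), (n + 1, 0, e1)), ((0, t, e1), (n + 1, 0, eL2)),
     ((0, t, eR1), (n, 0, eL1L2))} \<Longrightarrow> loc3 a1 a2 (t, n, eL2) North"
| "loc3 (0, 0, eL2) (n + 1, 0, e1) (0, n, eL2) North"

| "t < n \<Longrightarrow> (a1, a2) \<in> {((0, t + 1, e1), (n, 0, eR1)), ((0, t, eL2), (n, 0, eR2R1)),
     ((0, t + 1, eR1), (n, 0, e1))} \<Longrightarrow> loc3 a1 a2 (t, n, eR1) North"
| "1 \<le> n \<Longrightarrow> n \<le> t \<Longrightarrow> (a1, a2) \<in> {((n, 0, eR1), (0, t + 1, e1)), ((n, 0, e1), (0, t + 1, eR1)),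
     ((n, 0, eL2), (0, t, eR2R1))} \<Longrightarrow> loc3 a1 a2 (t, n, eR1) North"
| "loc3 (0, 0, eR1) (0, t + 1, e1) (t, 0, eR1) North"

| "loc3 a1 a2 b Y \<Longrightarrow> loc3 (times_UU a1) a2 (times_UU b) Y"
| "loc3 a1 a2 b Y \<Longrightarrow> loc3 a1 (times_UU a2) (times_UU b) Y"

fun local_op :: "gtype \<Rightarrow> lexpr list \<Rightarrow> lexpr \<Rightarrow> gtype \<Rightarrow> bool" where
  "local_op X [] b Y \<longleftrightarrow> loc1 X b Y"
| "local_op X [a] b Y \<longleftrightarrow> loc2 X a b Y"
| "local_op X [a1, a2] b Y \<longleftrightarrow> X = South \<and> loc3 a1 a2 b Y"
| "local_op X (a1 # a2 # a3 # as) b Y \<longleftrightarrow> False"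

text \<open>The expression \<open>t(p)\<close> describing \<open>p\<close> near the strands \<open>i\<close>, \<open>i + 1\<close>.\<close>

definition local_type :: "nat \<Rightarrow> pure \<Rightarrow> lexpr" where
  "local_type i p =
    (nat \<lfloor>wt p i\<rfloor>, nat \<lfloor>wt p (i + 1)\<rfloor>,
     (if wt p i \<in> \<int> \<and> wt p (i + 1) \<in> \<int> then e1
      else if wt p (i + 1) \<in> \<int> then
        (if vcount (src p) i < vcount (tgt p) i then eR1 else eL1)
      else if wt p i \<in> \<int> then
        (if vcount (src p) (i + 1) < vcount (tgt p) (i + 1) then eR2 else eL2)
      else (if vcount (src p) (i + 1) < vcount (tgt p) (i + 1) then eR2R1 else eL1L2)))"

text \<open>The positive crossing \<open>\<P>\<^sup>i\<close> with input \<open>\<A>(n,k,M)\<close>, where \<open>m = 2n\<close>.\<close>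

definition P_op :: "nat \<Rightarrow> nat \<Rightarrow> nat \<Rightarrow> nat set set \<Rightarrow> da_op" where
  "P_op m k i M X as b Y \<longleftrightarrow> X \<in> cross_gens m k i \<and> Y \<in> cross_gens m k i \<and>
    ((\<exists>ps q. as = map Bel ps \<and> b = Bel q \<and> (\<forall>p \<in> set ps. B_pure m k p) \<and> B_pure m k q \<and>
        composable (rid X) as (rid Y) \<and> src q = lid X \<and> tgt q = lid Y \<and>
        (\<forall>j. cross_gr i (kind X) j + (\<Sum>p\<leftarrow>ps. wt p (tau i j)) = wt q j + cross_gr i (kind Y) j) \<and>
        local_op (kind X) (map (local_type i) ps) (local_type i q) (kind Y)) \<or>
     (\<exists>p \<in> M. as = [Cel (rid X) p] \<and> b = Cel (lid X) (tau i ` p) \<and> Y = X) \<or>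
     ({i, i + 1} \<notin> M \<and> kind X = South \<and> rid Y = rid X \<and>
       (\<exists>j q. {i, j} \<in> M \<and> as = [Cel (rid X) {i, j}] \<and> b = Bel q \<and> kind Y = East \<and>
          q = Phi (lid X) (\<lambda>l. if l = j then 1 else 0) (lid Y) \<and>
          Phi (lid X) (\<lambda>_. 0) (lid Y) \<in> L_terms m k (i + 1) \<and> B_pure m k q)) \<or>
     ({i, i + 1} \<notin> M \<and> kind X = South \<and> rid Y = rid X \<and>
       (\<exists>j q. {i + 1, j} \<in> M \<and> as = [Cel (rid X) {i + 1, j}] \<and> b = Bel q \<and> kind Y = West \<and>
          q = Phi (lid X) (\<lambda>l. if l = j then 1 else 0) (lid Y) \<and>
          Phi (lid X) (\<lambda>_. 0) (lid Y) \<in> R_terms m k i \<and> B_pure m k q)))"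

text \<open>The dual generator of \<open>X\<close> is again denoted by \<open>X\<close>.\<close>

definition N_op :: "nat \<Rightarrow> nat \<Rightarrow> nat \<Rightarrow> nat set set \<Rightarrow> da_op" where
  "N_op m k i M Y as b X \<longleftrightarrow> P_op m k i M X (rev (map opp as)) (opp b) Y"


section \<open>Maxima and minima\<close>

definition phi :: "nat \<Rightarrow> nat \<Rightarrow> nat" where
  "phi c j = (if j < c then j else j + 2)"

definition max_psi :: "nat \<Rightarrow> nat set \<Rightarrow> nat set" where
  "max_psi c y = (if c + 1 \<in> y then insert (c - 1) (phi c -` y) else phi c -` y)"

definition max_gens :: "nat \<Rightarrow> nat \<Rightarrow> nat \<Rightarrow> dagen set" where
  "max_gens n k c = {Gen Qtype y (max_psi c y) | y.
     I_state (2*n + 2) (k + 1) y \<and> c \<in> y \<and> card (y \<inter> {c - 1, c + 1}) \<le> 1}"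

definition max_op :: "nat \<Rightarrow> nat \<Rightarrow> nat \<Rightarrow> nat set set \<Rightarrow> da_op" where
  "max_op n k c M X as b Z \<longleftrightarrow> X \<in> max_gens n k c \<and> Z \<in> max_gens n k c \<and>
    ((as = [] \<and> rid X = rid Z \<and>
       (\<exists>p q. ((p \<in> R_terms (2*n + 2) (k + 1) (c + 1) \<and> q \<in> R_terms (2*n + 2) (k + 1) c) \<or>
               (p \<in> L_terms (2*n + 2) (k + 1) c \<and> q \<in> L_terms (2*n + 2) (k + 1) (c + 1))) \<and>
          src p = lid X \<and> tgt p = src q \<and> tgt q = lid Z \<and>
          B_pure (2*n + 2) (k + 1) (p \<bullet>\<^sub>0 q) \<and> b = Bel (p \<bullet>\<^sub>0 q))) \<or>
     (as = [] \<and> Z = X \<and> b = Cel (lid X) {c, c + 1}) \<or>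
     (\<exists>a q. as = [Bel a] \<and> B_pure (2*n) k a \<and> src a = rid X \<and> tgt a = rid Z \<and>
        b = Bel q \<and> B_pure (2*n + 2) (k + 1) q \<and> src q = lid X \<and> tgt q = lid Z \<and>
        (\<forall>j \<in> {1..2*n}. wt q (phi c j) = wt a j) \<and> wt q c = 0 \<and> wt q (c + 1) = 0) \<or>
     (\<exists>p \<in> M. as = [Cel (rid X) p] \<and> Z = X \<and> b = Cel (lid X) (phi c ` p)))"

text \<open>For \<open>x = {x\<^sub>1 < x\<^sub>2 < \<dots>}\<close> the elements of \<open>x\<close> above 2 are
  \<open>x\<^sub>3, x\<^sub>4, \<dots>\<close> if \<open>x\<close> meets \<open>{0, 1, 2}\<close> in two points, and \<open>x\<^sub>2, x\<^sub>3, \<dots>\<close> if it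
  meets it in one.\<close>

definition min_psi :: "nat set \<Rightarrow> nat set" where
  "min_psi x = (if card (x \<inter> {0, 1, 2}) = 2 then {0} else {}) \<union> {j - 2 | j. j \<in> x \<and> 2 < j}"

definition min_gens :: "nat \<Rightarrow> nat \<Rightarrow> dagen set" where
  "min_gens n k = {Gen Ttype (min_psi x) x | x.
     I_state (2*n + 2) (k + 1) x \<and> x \<inter> {0, 1, 2} \<in> {{0}, {2}, {0, 2}}}"

datatype mvertex = vXL1 | vYR2 | vX | vY

text \<open>\<open>min_edge v u1 u2 r c v'\<close>: there is an edge from \<open>v\<close> to \<open>v'\<close> whose label has
  a \<open>\<B>\<close>-part of weights \<open>w\<^sub>1 = u1\<close>, \<open>w\<^sub>2 = u2\<close>, followed by \<open>r\<close> copies of \<open>C\<^sub>c\<close>.\<close>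

inductive min_edge :: "mvertex \<Rightarrow> rat \<Rightarrow> rat \<Rightarrow> nat \<Rightarrow> nat \<Rightarrow> mvertex \<Rightarrow> bool" where
  "min_edge vXL1 (of_nat r) 0 r 2 vXL1"
| "min_edge vXL1 (of_nat r + 1/2) 0 r 2 vY"
| "min_edge vX (of_nat r + 1/2) 0 r 2 vXL1"
| "min_edge vX (of_nat r + 1) 0 r 2 vY"
| "min_edge vY 0 (of_nat r + 1) r 1 vX"
| "min_edge vY 0 (of_nat r + 1/2) r 1 vYR2"
| "min_edge vYR2 0 (of_nat r) r 1 vYR2"
| "min_edge vYR2 0 (of_nat r + 1/2) r 1 vX"

text \<open>\<open>min_walk m k C v as\<close>: the sequence \<open>as\<close> is obtained from the labels of a path of
  positive length that starts at \<open>v\<close>, ends at \<open>vXL1\<close> or \<open>vYR2\<close>, and has no interior vertex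
  there; \<open>C c\<close> is the matched pair containing the strand \<open>c\<close>.\<close>

inductive min_walk :: "nat \<Rightarrow> nat \<Rightarrow> (nat \<Rightarrow> nat set) \<Rightarrow> mvertex \<Rightarrow> alg list \<Rightarrow> bool"
  for m k C where
  "min_edge v (wt p 1) (wt p 2) r c v' \<Longrightarrow> B_pure m k p \<Longrightarrow> v' \<in> {vXL1, vYR2} \<Longrightarrow>
     min_walk m k C v (Bel p # replicate r (Cel (tgt p) (C c)))"
| "min_edge v (wt p 1) (wt p 2) r c v' \<Longrightarrow> B_pure m k p \<Longrightarrow> v' \<notin> {vXL1, vYR2} \<Longrightarrow>
     min_walk m k C v' as \<Longrightarrow>
     min_walk m k C v (Bel p # replicate r (Cel (tgt p) (C c)) @ as)"

text \<open>\<open>\<mho>\<^sup>1\<close>, with input \<open>\<A>(n+1,k+1,M)\<close>, where \<open>{1, \<alpha> + 2}\<close> and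
  \<open>{2, \<beta> + 2}\<close> belong to \<open>M\<close>.\<close>

definition min_matching :: "nat set set \<Rightarrow> nat set set" where
  "min_matching M = {{\<alpha>, \<beta>} | \<alpha> \<beta>. {1, phi 1 \<alpha>} \<in> M \<and> {2, phi 1 \<beta>} \<in> M} \<union> {q. phi 1 ` q \<in> M}"

definition min_op :: "nat \<Rightarrow> nat \<Rightarrow> nat set set \<Rightarrow> da_op" where
  "min_op n k M X as b Z \<longleftrightarrow> X \<in> min_gens n k \<and> Z \<in> min_gens n k \<and>
    (\<exists>\<alpha> \<beta>. {1, phi 1 \<alpha>} \<in> M \<and> {2, phi 1 \<beta>} \<in> M \<and>
     ((\<exists>q \<in> min_matching M - {{\<alpha>, \<beta>}}. as = [Cel (rid X) (phi 1 ` q)] \<and>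
          b = Cel (lid X) q \<and> Z = X) \<or>
      (0 \<in> rid X \<and> as = [Cel (rid X) {1, phi 1 \<alpha>}, Cel (rid X) {2, phi 1 \<beta>}] \<and>
          b = Cel (lid X) {\<alpha>, \<beta>} \<and> Z = X) \<or>
      (0 \<notin> rid X \<and> as = [Cel (rid X) {2, phi 1 \<beta>}, Cel (rid X) {1, phi 1 \<alpha>}] \<and>
          b = Cel (lid X) {\<alpha>, \<beta>} \<and> Z = X) \<or>
      (\<exists>q. b = Bel q \<and> B_pure (2*n) k q \<and> src q = lid X \<and> tgt q = lid Z \<and>
          composable (rid X) as (rid Z) \<and>
          min_walk (2*n + 2) (k + 1) (\<lambda>c. if c = 1 then {1, phi 1 \<alpha>} else {2, phi 1 \<beta>})
            (if 0 \<in> rid X then vXL1 else vYR2) as \<and>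
          (\<forall>j \<in> {1..2*n}. wt q j = (\<Sum>a\<leftarrow>as. alg_wt a (j + 2))))))"


section \<open>The complex of a sequence of events\<close>

text \<open>
  An event is a maximum creating strands \<open>c\<close>, \<open>c + 1\<close> (the flag says whether strand \<open>c\<close> is
  oriented upwards), a minimum joining strands \<open>c\<close>, \<open>c + 1\<close>, or a crossing of strands \<open>i\<close>,
  \<open>i + 1\<close> (the flag says whether it is positive when both strands are oriented upwards).
\<close>

datatype event = Maximum bool nat | Minimum nat | Crossing bool nat

text \<open>The data of a generic level: matching, orientations of the strands (from left to right,
  \<open>True\<close> for upwards), type D structure of the part above, gradings of its generators.\<close>

record level =
  matching :: "nat set set"
  ups :: "bool list"
  struct :: typeD
  grA :: "dagen list \<Rightarrow> rat"
  gr\<Delta> :: "dagen list \<Rightarrow> rat"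

definition top_level :: level where
  "top_level = \<lparr>matching = {}, ups = [], struct = \<lparr>dgens = {[]}, dcoef = (\<lambda>_ _ _. False)\<rparr>,
     grA = (\<lambda>_. 0), gr\<Delta> = (\<lambda>_. 0)\<rparr>"

text \<open>Whether both edges bounding the given quadrant of a crossing are outgoing, where \<open>a\<close> and
  \<open>b\<close> tell whether the strands through the lower left and the lower right edge are oriented
  upwards.  Both edges are incoming iff they are outgoing for the reversed orientation.\<close>

fun both_outgoing :: "gtype \<Rightarrow> bool \<Rightarrow> bool \<Rightarrow> bool" where
  "both_outgoing North a b \<longleftrightarrow> a \<and> b"
| "both_outgoing South a b \<longleftrightarrow> \<not> a \<and> \<not> b"
| "both_outgoing West a b \<longleftrightarrow> \<not> a \<and> b"
| "both_outgoing East a b \<longleftrightarrow> a \<and> \<not> b"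
| "both_outgoing _ a b \<longleftrightarrow> False"

definition crossing_sign :: "bool \<Rightarrow> bool \<Rightarrow> bool \<Rightarrow> rat" where
  "crossing_sign pos a b = (if pos then 1 else - 1) * (if a = b then 1 else - 1)"

definition quadrant_A :: "bool \<Rightarrow> bool \<Rightarrow> bool \<Rightarrow> gtype \<Rightarrow> rat" where
  "quadrant_A pos a b X =
     (if both_outgoing X a b then - crossing_sign pos a b / 2
      else if both_outgoing X (\<not> a) (\<not> b) then crossing_sign pos a b / 2
      else 0)"

definition quadrant_\<Delta> :: "bool \<Rightarrow> bool \<Rightarrow> bool \<Rightarrow> gtype \<Rightarrow> rat" where
  "quadrant_\<Delta> pos a b X =
     (if both_outgoing X a b \<or> both_outgoing X (\<not> a) (\<not> b) then - crossing_sign pos a b / 2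
      else 0)"

definition max_step :: "bool \<Rightarrow> nat \<Rightarrow> level \<Rightarrow> level" where
  "max_step u c l =
    (let n = length (ups l) div 2 in
     \<lparr>matching = (`) (phi c) ` matching l \<union> {{c, c + 1}},
      ups = take (c - 1) (ups l) @ [u, \<not> u] @ drop (c - 1) (ups l),
      struct = box (max_gens n n c) (max_op n n c (matching l)) (struct l),
      grA = (\<lambda>g. grA l (tl g)), gr\<Delta> = (\<lambda>g. gr\<Delta> l (tl g))\<rparr>)"

definition cross_step :: "bool \<Rightarrow> nat \<Rightarrow> level \<Rightarrow> level" where
  "cross_step pos i l =
    (let m = length (ups l); n = m div 2; a = ups l ! i; b = ups l ! (i - 1) in
     \<lparr>matching = (`) (tau i) ` matching l,
      ups = (ups l)[i - 1 := a, i := b],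
      struct = box (cross_gens m n i)
        ((if pos then P_op else N_op) m n i (matching l)) (struct l),
      grA = (\<lambda>g. quadrant_A pos a b (kind (hd g)) + grA l (tl g)),
      gr\<Delta> = (\<lambda>g. quadrant_\<Delta> pos a b (kind (hd g)) + gr\<Delta> l (tl g))\<rparr>)"

text \<open>
  \<open>\<mho>\<^sup>c\<close> for \<open>c > 1\<close> is \<open>\<mho>\<^bsup>c-1\<^esup> \<boxtimes> \<P>\<^sup>c \<boxtimes> \<P>\<^bsup>c-1\<^esup>\<close>.  The crossings introduced in this way
  are treated like all other crossings in the definition of the gradings; otherwise the
  differential would not be homogeneous.
\<close>

fun min_step :: "nat \<Rightarrow> level \<Rightarrow> level" where
  "min_step 0 l = l"
| "min_step (Suc 0) l =
    (let n = length (ups l) div 2 - 1 in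
     \<lparr>matching = min_matching (matching l),
      ups = drop 2 (ups l),
      struct = box (min_gens n n) (min_op n n (matching l)) (struct l),
      grA = (\<lambda>g. grA l (tl g)), gr\<Delta> = (\<lambda>g. gr\<Delta> l (tl g))\<rparr>)"
| "min_step (Suc (Suc c)) l =
    min_step (Suc c) (cross_step True (Suc (Suc c)) (cross_step True (Suc c) l))"

text \<open>Events that do not fit the number of strands never occur for a diagram of a knot, nor
  does a minimum other than the global one at a level with two strands.\<close>

fun step :: "event \<Rightarrow> level \<Rightarrow> level" where
  "step (Maximum u c) l =
    (if 1 \<le> c \<and> c \<le> length (ups l) + 1 then max_step u c l else l)"
| "step (Minimum c) l =
    (if 1 \<le> c \<and> c + 1 \<le> length (ups l) \<and> 4 \<le> length (ups l) then min_step c l else l)"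
| "step (Crossing pos i) l =
    (if 1 \<le> i \<and> i + 1 \<le> length (ups l) then cross_step pos i l else l)"

text \<open>The coefficient in \<open>\<R>\<close> of \<open>g'\<close> in \<open>\<partial>g\<close>, obtained from \<open>\<delta>\<^sup>1\<close> by setting
  \<open>C = 0\<close> and \<open>U\<^sub>1, U\<^sub>2 = U, V\<close> (or \<open>V, U\<close>, if strand 1 points downwards).\<close>

definition final_coef :: "level \<Rightarrow> dagen list \<Rightarrow> dagen list \<Rightarrow> fuv set" where
  "final_coef l g g' =
    (\<Oplus>\<^bsub>RUV\<^esub>p \<in> {p. dcoef (struct l) g (Bel p) g'}.
       (if hd (ups l) then R_monom (expo p 1) (expo p 2) else R_monom (expo p 2) (expo p 1)))"

definition final_complex :: "level \<Rightarrow> (dagen list \<Rightarrow> fuv set) bigraded" where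
  "final_complex l = free_bigraded (dgens (struct l)) (gr\<Delta> l) (grA l)"

definition final_diff ::
  "level \<Rightarrow> (dagen list \<Rightarrow> fuv set) \<Rightarrow> (dagen list \<Rightarrow> fuv set)" where
  "final_diff l f = (\<lambda>g' \<in> dgens (struct l).
     \<Oplus>\<^bsub>RUV\<^esub>g \<in> dgens (struct l). f g \<otimes>\<^bsub>RUV\<^esub> final_coef l g g')"


section \<open>Oriented knots and their diagrams\<close>

definition knot_x :: "(real \<Rightarrow> real^3) \<Rightarrow> real \<Rightarrow> real" where "knot_x K t = K t $ 1"
definition knot_y :: "(real \<Rightarrow> real^3) \<Rightarrow> real \<Rightarrow> real" where "knot_y K t = K t $ 2"
definition knot_z :: "(real \<Rightarrow> real^3) \<Rightarrow> real \<Rightarrow> real" where "knot_z K t = K t $ 3"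

text \<open>An oriented knot is given by a smooth regular 1-periodic parametrization that is
  injective modulo the period, with the orientation of increasing parameter.\<close>

definition oriented_knot :: "(real \<Rightarrow> real^3) \<Rightarrow> bool" where
  "oriented_knot K \<longleftrightarrow>
     (\<forall>i n t. ((deriv ^^ n) (\<lambda>s. K s $ i)) differentiable (at t)) \<and>
     (\<forall>t. \<exists>i. deriv (\<lambda>s. K s $ i) t \<noteq> 0) \<and>
     (\<forall>s t. K s = K t \<longleftrightarrow> s - t \<in> \<int>)"

definition reverse_knot :: "(real \<Rightarrow> real^3) \<Rightarrow> real \<Rightarrow> real^3" where
  "reverse_knot K = (\<lambda>t. K (- t))"

text \<open>Oriented ambient isotopy; \<open>\<theta>\<close> is an orientation preserving change of parameter.\<close>

definition isotopic_knots :: "(real \<Rightarrow> real^3) \<Rightarrow> (real \<Rightarrow> real^3) \<Rightarrow> bool" where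
  "isotopic_knots K L \<longleftrightarrow> (\<exists>H \<theta>.
     continuous_on ({0..1} \<times> UNIV) H \<and>
     (\<forall>s \<in> {0..1::real}. \<exists>G. homeomorphism UNIV UNIV (\<lambda>p. H (s, p)) G) \<and>
     (\<forall>p. H (0, p) = p) \<and>
     continuous_on UNIV \<theta> \<and> strict_mono \<theta> \<and> (\<forall>t::real. \<theta> (t + 1) = \<theta> t + 1) \<and>
     (\<forall>t. H (1, K t) = L (\<theta> t)))"

text \<open>Diagrams are obtained by projecting along the third coordinate, looking from
  \<open>z = +\<infinity>\<close>; the height function is the second coordinate.  Critical points and double
  points of the projection are recorded as sets of one, respectively two, parameters in
  \<open>[0, 1)\<close>.\<close>

definition critical_points :: "(real \<Rightarrow> real^3) \<Rightarrow> real set set" where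
  "critical_points D = {{t} | t. t \<in> {0..<1} \<and> deriv (knot_y D) t = 0}"

definition double_points :: "(real \<Rightarrow> real^3) \<Rightarrow> real set set" where
  "double_points D = {{s, t} | s t. s \<in> {0..<1} \<and> t \<in> {0..<1} \<and> s \<noteq> t \<and>
     knot_x D s = knot_x D t \<and> knot_y D s = knot_y D t}"

definition events :: "(real \<Rightarrow> real^3) \<Rightarrow> real set set" where
  "events D = critical_points D \<union> double_points D"

definition tangent_det :: "(real \<Rightarrow> real^3) \<Rightarrow> real \<Rightarrow> real \<Rightarrow> real" where
  "tangent_det D s t =
     deriv (knot_x D) s * deriv (knot_y D) t - deriv (knot_y D) s * deriv (knot_x D) t"

text \<open>The last condition says that all maxima, minima and crossings have distinct heights; in
  particular there are no triple points.  It also makes the global minimum unique, and this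
  is the marked point.\<close>

definition bridge_position :: "(real \<Rightarrow> real^3) \<Rightarrow> bool" where
  "bridge_position D \<longleftrightarrow>
     (\<forall>t. deriv (knot_x D) t \<noteq> 0 \<or> deriv (knot_y D) t \<noteq> 0) \<and>
     (\<forall>s t. {s, t} \<in> double_points D \<longrightarrow> tangent_det D s t \<noteq> 0) \<and>
     (\<forall>t. deriv (knot_y D) t = 0 \<longrightarrow> deriv (deriv (knot_y D)) t \<noteq> 0) \<and>
     (\<forall>A \<in> events D. \<forall>B \<in> events D. \<forall>s \<in> A. \<forall>t \<in> B. knot_y D s = knot_y D t \<longrightarrow> A = B)"

definition bridge_diagram :: "(real \<Rightarrow> real^3) \<Rightarrow> (real \<Rightarrow> real^3) \<Rightarrow> bool" where
  "bridge_diagram K D \<longleftrightarrow> oriented_knot D \<and> bridge_position D \<and> isotopic_knots D K"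

definition event_heights :: "(real \<Rightarrow> real^3) \<Rightarrow> real set" where
  "event_heights D = {knot_y D t | t A. A \<in> events D \<and> t \<in> A}"

text \<open>One plus the number of strands to the left of the event at height \<open>h\<close>.\<close>

definition event_position :: "(real \<Rightarrow> real^3) \<Rightarrow> real \<Rightarrow> nat" where
  "event_position D h = Suc (card {t \<in> {0..<1}. knot_y D t = h \<and>
     (\<exists>A \<in> events D. \<exists>s \<in> A. knot_y D s = h \<and> knot_x D t < knot_x D s)})"

text \<open>At a maximum with \<open>x\<close> increasing the left strand is the incoming one.  At a crossing
  with over-strand \<open>s\<close> and under-strand \<open>t\<close>, the last condition is positivity after both
  strands have been oriented upwards.\<close>

definition event_at :: "(real \<Rightarrow> real^3) \<Rightarrow> real \<Rightarrow> event" where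
  "event_at D h =
    (if \<exists>t. knot_y D t = h \<and> deriv (knot_y D) t = 0 \<and> deriv (deriv (knot_y D)) t < 0
     then Maximum (\<exists>t. knot_y D t = h \<and> deriv (knot_y D) t = 0 \<and> deriv (knot_x D) t > 0)
            (event_position D h)
     else if \<exists>t. knot_y D t = h \<and> deriv (knot_y D) t = 0
     then Minimum (event_position D h)
     else Crossing
            (\<exists>s t. {s, t} \<in> double_points D \<and> knot_y D s = h \<and> knot_z D s > knot_z D t \<and>
               tangent_det D s t * deriv (knot_y D) s * deriv (knot_y D) t > 0)
            (event_position D h))"

text \<open>All events from top to bottom, except for the global minimum.\<close>

definition event_sequence :: "(real \<Rightarrow> real^3) \<Rightarrow> event list" where
  "event_sequence D = butlast (map (event_at D) (rev (sorted_list_of_set (event_heights D))))"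

definition HC :: "(real \<Rightarrow> real^3) \<Rightarrow> (dagen list \<Rightarrow> fuv set) set bigraded" where
  "HC D = (let l = fold step (event_sequence D) top_level
           in homology (final_complex l) (final_diff l))"

text \<open>
  The modules \<open>H(\<C>(D))\<close> for all bridge position diagrams \<open>D\<close> of \<open>K\<close>.  The module
  \<open>\<J>(K)\<close> is any one of them; they are isomorphic to each other, since \<open>\<J>(K)\<close> is an
  invariant of \<open>K\<close>.
\<close>

definition J :: "(real \<Rightarrow> real^3) \<Rightarrow> (dagen list \<Rightarrow> fuv set) set bigraded set" where
  "J K = HC ` {D. bridge_diagram K D}"

end

theory Submission
  imports Defs
begin

text \<open>
  Reversing the parametrization turns a bridge position diagram of \<open>K\<close> into one of \<open>-K\<close>
  with the same maxima, minima and crossings, at the same heights; the sign of a crossing with both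
  strands oriented upwards is unchanged, too.  So the type D structures agree, and only the
  orientations of the strands are reversed.  Crossing signs are invariant under this, but incoming
  and outgoing quadrants are exchanged: \<open>\<Delta>\<close> is kept and \<open>A\<close> is negated.  Finally, strand 1 above
  the global minimum changes its direction, which exchanges \<open>U\<close> and \<open>V\<close> in the differential.
  Applying the automorphism \<open>U \<leftrightarrow> V\<close> of \<open>\<R>\<close> to all coefficients is therefore an isomorphism
  of complexes up to the twist \<open>S\<close>.
\<close>

section \<open>The exchange of \<open>U\<close> and \<open>V\<close>\<close>

abbreviation swap_poly :: "fuv \<Rightarrow> fuv" where
  "swap_poly \<equiv> Poly_Mapping.map_key prod.swap"

lemma lookup_swap_poly: "Poly_Mapping.lookup (swap_poly p) k = Poly_Mapping.lookup p (prod.swap k)"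
  by (simp add: map_key.rep_eq)

lemma swap_poly_swap_poly [simp]: "swap_poly (swap_poly p) = p"
  by (rule poly_mapping_eqI) (simp add: lookup_swap_poly)

lemma swap_poly_plus: "swap_poly (p + q) = swap_poly p + swap_poly q"
  by (rule poly_mapping_eqI) (simp add: lookup_swap_poly lookup_add)

lemma swap_poly_single [simp]:
  "swap_poly (Poly_Mapping.single (a, b) v) = Poly_Mapping.single (b, a) v"
  by (rule poly_mapping_eqI) (auto simp: lookup_swap_poly lookup_single when_def)

lemma swap_poly_one [simp]: "swap_poly 1 = 1"
  by (rule poly_mapping_eqI)
    (auto simp: lookup_swap_poly lookup_one when_def zero_prod_def prod.swap_def)

text \<open>\<open>prod.swap\<close> is an additive automorphism of the exponents, so both sums of
  the convolution can be reindexed along it.\<close>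

lemma swap_poly_times: "swap_poly (p * q) = swap_poly p * swap_poly q"
proof (rule poly_mapping_eqI)
  fix k :: "nat \<times> nat"
  have swap_eq: "prod.swap k = l + m \<longleftrightarrow> k = prod.swap l + prod.swap m" for l m
    by (cases k; cases l; cases m) auto
  have inner: "Sum_any (\<lambda>m. Poly_Mapping.lookup q m when prod.swap k = l + m) =
      Sum_any (\<lambda>m. Poly_Mapping.lookup q (prod.swap m) when k = prod.swap l + m)" for l
    by (rule Sum_any.reindex_cong[of prod.swap]) (auto simp: swap_eq fun_eq_iff)
  have "Sum_any (\<lambda>l. Poly_Mapping.lookup p l *
        Sum_any (\<lambda>m. Poly_Mapping.lookup q m when prod.swap k = l + m)) =
      Sum_any (\<lambda>l. Poly_Mapping.lookup p (prod.swap l) *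
        Sum_any (\<lambda>m. Poly_Mapping.lookup q (prod.swap m) when k = l + m))"
    by (rule Sum_any.reindex_cong[of prod.swap]) (auto simp: inner fun_eq_iff)
  then show "Poly_Mapping.lookup (swap_poly (p * q)) k =
      Poly_Mapping.lookup (swap_poly p * swap_poly q) k"
    by (simp add: lookup_swap_poly lookup_mult)
qed

section \<open>The quotient ring and its induced automorphism\<close>

lemma cring_FUV: "cring FUV"
proof (rule cringI)
  show "abelian_group FUV"
  proof (rule abelian_groupI)
    fix p assume "p \<in> carrier FUV"
    show "\<exists>q\<in>carrier FUV. q \<oplus>\<^bsub>FUV\<^esub> p = \<zero>\<^bsub>FUV\<^esub>"
      by (rule bexI[of _ "- p"]) (auto simp: FUV_def)
  qed (auto simp: FUV_def add_ac)
  show "Group.comm_monoid FUV"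
    by (rule Group.comm_monoidI) (auto simp: FUV_def mult_ac)
qed (auto simp: FUV_def distrib_right)

text \<open>In a commutative ring a principal ideal consists of the multiples of its generator; in
  this form the symmetry of the generator \<open>UV\<close> can be used.\<close>

lemma UV_ideal_eq: "UV_ideal = range (\<lambda>p. p * Poly_Mapping.single (1, 1) 1)"
proof -
  interpret cring FUV by (rule cring_FUV)
  show ?thesis
    unfolding UV_ideal_def
    by (subst cgenideal_eq_genideal[symmetric]) (auto simp: FUV_def cgenideal_def)
qed

lemma ideal_UV: "ideal UV_ideal FUV"
  unfolding UV_ideal_def
  by (rule ring.genideal_ideal[OF cring.axioms(1)[OF cring_FUV]]) (simp add: FUV_def)

lemma cring_RUV: "cring RUV"
  unfolding RUV_def by (rule ideal.quotient_is_cring[OF ideal_UV cring_FUV])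

lemma FUV_coset: "UV_ideal +>\<^bsub>FUV\<^esub> p = (\<lambda>u. u + p) ` UV_ideal"
  by (auto simp: a_r_coset_def' FUV_def)

lemma carrier_RUV: "carrier RUV = range (\<lambda>p. UV_ideal +>\<^bsub>FUV\<^esub> p)"
  by (auto simp: RUV_def FactRing_def A_RCOSETS_def' FUV_def)

lemma R_swap_R_swap [simp]: "R_swap (R_swap X) = X"
  by (simp add: R_swap_def image_image)

lemma R_swap_UV_ideal: "R_swap UV_ideal = UV_ideal"
proof -
  have "R_swap UV_ideal \<subseteq> UV_ideal"
    by (auto simp: R_swap_def UV_ideal_eq swap_poly_times)
  \<comment> \<open>\<open>R_swap\<close> is an involution, so applying it to the inclusion just
    shown yields the opposite one.\<close>
  moreover from this have "R_swap (R_swap UV_ideal) \<subseteq> R_swap UV_ideal"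
    unfolding R_swap_def by (rule image_mono)
  ultimately show ?thesis by simp
qed

text \<open>\<open>R_swap\<close> is defined as an image of subsets, hence without choosing
  representatives; this identifies it with the map that \<open>swap_poly\<close> induces on the
  quotient.\<close>

lemma R_swap_coset: "R_swap (UV_ideal +>\<^bsub>FUV\<^esub> p) = UV_ideal +>\<^bsub>FUV\<^esub> swap_poly p"
proof -
  have "R_swap (UV_ideal +>\<^bsub>FUV\<^esub> p) = (\<lambda>u. u + swap_poly p) ` R_swap UV_ideal"
    by (simp add: R_swap_def FUV_coset image_image swap_poly_plus)
  then show ?thesis by (simp add: R_swap_UV_ideal FUV_coset)
qed

lemma R_swap_R_monom [simp]: "R_swap (R_monom a b) = R_monom b a"
  by (simp add: R_monom_def R_swap_coset)

lemma R_monom_closed [simp]: "R_monom a b \<in> carrier RUV"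
  by (auto simp: R_monom_def carrier_RUV)

lemma R_swap_closed [simp]: "X \<in> carrier RUV \<Longrightarrow> R_swap X \<in> carrier RUV"
  by (auto simp: carrier_RUV R_swap_coset)

lemma R_swap_ring_hom: "R_swap \<in> ring_hom RUV RUV"
proof (rule ring_hom_memI)
  interpret ideal UV_ideal FUV by (rule ideal_UV)
  fix X Y assume "X \<in> carrier RUV" "Y \<in> carrier RUV"
  then obtain p q where X: "X = UV_ideal +>\<^bsub>FUV\<^esub> p" and Y: "Y = UV_ideal +>\<^bsub>FUV\<^esub> q"
    by (auto simp: carrier_RUV)
  have carr: "r \<in> carrier FUV" for r by (simp add: FUV_def)
  have "(UV_ideal +>\<^bsub>FUV\<^esub> r) \<otimes>\<^bsub>RUV\<^esub> (UV_ideal +>\<^bsub>FUV\<^esub> s) = UV_ideal +>\<^bsub>FUV\<^esub> r * s" for r s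
    using rcoset_mult_add[of r s] by (simp add: RUV_def FactRing_def carr) (simp add: FUV_def)
  then show "R_swap (X \<otimes>\<^bsub>RUV\<^esub> Y) = R_swap X \<otimes>\<^bsub>RUV\<^esub> R_swap Y"
    by (simp add: X Y R_swap_coset swap_poly_times)
  have "(UV_ideal +>\<^bsub>FUV\<^esub> r) \<oplus>\<^bsub>RUV\<^esub> (UV_ideal +>\<^bsub>FUV\<^esub> s) = UV_ideal +>\<^bsub>FUV\<^esub> r + s" for r s
    using a_rcos_sum[of r s] by (simp add: RUV_def FactRing_def carr) (simp add: FUV_def)
  then show "R_swap (X \<oplus>\<^bsub>RUV\<^esub> Y) = R_swap X \<oplus>\<^bsub>RUV\<^esub> R_swap Y"
    by (simp add: X Y R_swap_coset swap_poly_plus)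
next
  have "\<one>\<^bsub>RUV\<^esub> = UV_ideal +>\<^bsub>FUV\<^esub> 1" by (simp add: RUV_def FactRing_def FUV_def)
  then show "R_swap \<one>\<^bsub>RUV\<^esub> = \<one>\<^bsub>RUV\<^esub>" by (simp add: R_swap_coset)
qed simp

text \<open>Makes \<open>hom_finsum\<close> available, which moves \<open>R_swap\<close> inside the
  sums that define the differential.\<close>

interpretation R_swap: ring_hom_cring RUV RUV R_swap
  by (intro ring_hom_cring.intro ring_hom_cring_axioms.intro cring_RUV R_swap_ring_hom)

text \<open>Exchanging the exponents of a monomial keeps \<open>- a - b\<close> and negates
  \<open>b - a\<close>, so a homogeneous representative goes to a homogeneous one.\<close>

lemma R_comp_swap:
  assumes "X \<in> R_comp d s"
  shows "R_swap X \<in> R_comp d (- s)"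
proof -
  obtain p where X: "X = UV_ideal +>\<^bsub>FUV\<^esub> p"
    and deg: "\<forall>(a, b) \<in> Poly_Mapping.keys p.
      - of_nat a - of_nat b = d \<and> of_nat b - of_nat a = s"
    using assms unfolding R_comp_def mem_Collect_eq by (elim exE conjE)
  have "\<forall>(a, b) \<in> Poly_Mapping.keys (swap_poly p).
      - of_nat a - of_nat b = d \<and> of_nat b - of_nat a = - s"
  proof (intro ballI, clarify)
    fix a b assume "(a, b) \<in> Poly_Mapping.keys (swap_poly p)"
    then have "(b, a) \<in> Poly_Mapping.keys p"
      by (simp add: in_keys_iff lookup_swap_poly)
    with deg have "- of_nat b - of_nat a = d \<and> of_nat a - of_nat b = s"
      by fast
    then show "- of_nat a - of_nat b = d \<and> of_nat b - of_nat a = - s"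
      by linarith
  qed
  then show ?thesis
    unfolding R_comp_def X R_swap_coset mem_Collect_eq
    by (intro exI[of _ "swap_poly p"] conjI[OF refl])
qed

lemma R_swap_in_R_comp_iff [simp]: "R_swap X \<in> R_comp d s \<longleftrightarrow> X \<in> R_comp d (- s)"
proof
  show "X \<in> R_comp d (- s)" if "R_swap X \<in> R_comp d s"
    using R_comp_swap[OF that] by (simp only: R_swap_R_swap)
  show "R_swap X \<in> R_comp d s" if "X \<in> R_comp d (- s)"
    using R_comp_swap[OF that] by (simp only: minus_minus)
qed

text \<open>A bijective chain map acts elementwise on the cosets of the image of the differential.\<close>

lemma homology_iso_S_op:
  assumes bij: "bij_betw \<phi> (carrier C) (carrier C')"
    and add: "\<And>x y. x \<in> carrier C \<Longrightarrow> y \<in> carrier C \<Longrightarrow> \<phi> (x \<oplus>\<^bsub>C\<^esub> y) = \<phi> x \<oplus>\<^bsub>C'\<^esub> \<phi> y"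
    and add_closed: "\<And>x y. x \<in> carrier C \<Longrightarrow> y \<in> carrier C \<Longrightarrow> x \<oplus>\<^bsub>C\<^esub> y \<in> carrier C"
    and zero: "\<zero>\<^bsub>C\<^esub> \<in> carrier C" "\<phi> \<zero>\<^bsub>C\<^esub> = \<zero>\<^bsub>C'\<^esub>"
    and smult: "\<And>r x. r \<in> carrier RUV \<Longrightarrow> x \<in> carrier C \<Longrightarrow>
      \<phi> (r \<odot>\<^bsub>C\<^esub> x) = R_swap r \<odot>\<^bsub>C'\<^esub> \<phi> x"
    and smult_closed: "\<And>r x. r \<in> carrier RUV \<Longrightarrow> x \<in> carrier C \<Longrightarrow> r \<odot>\<^bsub>C\<^esub> x \<in> carrier C"
    and diff: "\<And>x. x \<in> carrier C \<Longrightarrow> \<phi> (df x) = df' (\<phi> x)"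
    and diff_closed: "\<And>x. x \<in> carrier C \<Longrightarrow> df x \<in> carrier C"
    and comp: "\<And>d s. \<phi> ` comp C d s = comp C' d (- s)"
    and comp_closed: "\<And>d s. comp C d s \<subseteq> carrier C"
  shows "homology C df \<cong>\<^sub>b S_op (homology C' df')"
proof -
  define B where "B = df ` carrier C"
  define B' where "B' = df' ` carrier C'"
  define Z where "Z = {z \<in> carrier C. df z = \<zero>\<^bsub>C\<^esub>}"
  define Z' where "Z' = {z \<in> carrier C'. df' z = \<zero>\<^bsub>C'\<^esub>}"
  have inj: "inj_on \<phi> (carrier C)" and img: "\<phi> ` carrier C = carrier C'"
    using bij by (auto simp: bij_betw_def)
  have B_sub: "B \<subseteq> carrier C" using diff_closed by (auto simp: B_def)
  have Z_sub: "Z \<subseteq> carrier C" by (auto simp: Z_def)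
  have \<phi>_B: "\<phi> ` B = B'"
    unfolding B_def B'_def img[symmetric] image_image by (rule image_cong) (auto simp: diff)
  \<comment> \<open>Injectivity enters here: \<open>df' (\<phi> z)\<close> is
    \<open>\<phi> (df z)\<close>, which equals \<open>\<phi>\<close> of zero only if
    \<open>df z\<close> is zero.\<close>
  have mem_Z: "\<phi> z \<in> Z' \<longleftrightarrow> z \<in> Z" if "z \<in> carrier C" for z
    using that img inj_on_eq_iff[OF inj diff_closed[OF that] zero(1)]
    by (auto simp: Z_def Z'_def diff[symmetric] zero(2))
  have "Z' \<subseteq> \<phi> ` carrier C"
    by (auto simp: img Z'_def)
  then have \<phi>_Z: "\<phi> ` Z = Z'"
    using mem_Z Z_sub by blast
  have coset: "\<phi> ` (B +>\<^bsub>C\<^esub> z) = B' +>\<^bsub>C'\<^esub> \<phi> z" if "z \<in> carrier C" for z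
    unfolding a_r_coset_def' \<phi>_B[symmetric] using B_sub that by (auto simp: image_UN add subset_iff)
  have coset_sub: "B +>\<^bsub>C\<^esub> z \<subseteq> carrier C" if "z \<in> carrier C" for z
    unfolding a_r_coset_def' using B_sub that by (auto intro!: add_closed)
  have set_add: "\<phi> ` (X <+>\<^bsub>C\<^esub> Y) = \<phi> ` X <+>\<^bsub>C'\<^esub> \<phi> ` Y"
    if "X \<subseteq> carrier C" "Y \<subseteq> carrier C" for X Y
    unfolding set_add_def' using that by (auto simp: image_UN add subset_iff)
  let ?H = "homology C df" and ?H' = "homology C' df'"
  have carr: "carrier ?H = (+>\<^bsub>C\<^esub>) B ` Z" "carrier ?H' = (+>\<^bsub>C'\<^esub>) B' ` Z'"
    by (auto simp: homology_def Let_def B_def B'_def Z_def Z'_def)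
  have comps: "comp ?H d s = (+>\<^bsub>C\<^esub>) B ` (Z \<inter> comp C d s)"
    "comp ?H' d s = (+>\<^bsub>C'\<^esub>) B' ` (Z' \<inter> comp C' d s)" for d s
    by (auto simp: homology_def Let_def B_def B'_def Z_def Z'_def)
  have image_coset: "image \<phi> ` ((+>\<^bsub>C\<^esub>) B ` A) = (+>\<^bsub>C'\<^esub>) B' ` (\<phi> ` A)" if "A \<subseteq> carrier C" for A
    unfolding image_image by (rule image_cong) (use that coset in auto)
  have sub: "X \<subseteq> carrier C" if "X \<in> carrier ?H" for X
    using that coset_sub Z_sub by (auto simp: carr)
  have image_carr: "image \<phi> ` carrier ?H = carrier ?H'"
    unfolding carr image_coset[OF Z_sub] \<phi>_Z ..
  show ?thesis
    unfolding bigraded_iso_def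
  proof (intro bexI[of _ "image \<phi>"] conjI ballI allI)
    show "image \<phi> \<in> iso (add_monoid ?H) (add_monoid (S_op ?H'))"
    proof (intro isoI homI)
      have "inj_on (image \<phi>) (carrier ?H)"
        by (intro inj_onI) (metis inj inj_on_image_eq_iff sub)
      then show "bij_betw (image \<phi>) (carrier (add_monoid ?H)) (carrier (add_monoid (S_op ?H')))"
        using image_carr by (simp add: bij_betw_def S_op_def)
      show "\<phi> ` X \<in> carrier (add_monoid (S_op ?H'))" if "X \<in> carrier (add_monoid ?H)" for X
        using image_carr that by (auto simp: S_op_def)
      show "\<phi> ` (X \<otimes>\<^bsub>add_monoid ?H\<^esub> Y) = \<phi> ` X \<otimes>\<^bsub>add_monoid (S_op ?H')\<^esub> \<phi> ` Y"
        if "X \<in> carrier (add_monoid ?H)" "Y \<in> carrier (add_monoid ?H)" for X Y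
        using set_add[OF sub sub, of X Y] that by (simp add: S_op_def) (simp add: homology_def Let_def)
    qed
  next
    fix r X assume r: "r \<in> carrier RUV" and X: "X \<in> carrier ?H"
    \<comment> \<open>Scalar multiplication on homology is a union over the elements of a class, so
      both sides are compared term by term; \<open>R_swap r\<close> is the scalar by which
      \<open>S_op\<close> lets \<open>r\<close> act.\<close>
    have "\<phi> ` (\<Union>x\<in>X. B +>\<^bsub>C\<^esub> (r \<odot>\<^bsub>C\<^esub> x)) = (\<Union>x\<in>X. B' +>\<^bsub>C'\<^esub> (R_swap r \<odot>\<^bsub>C'\<^esub> \<phi> x))"
      unfolding image_UN
    proof (rule SUP_cong)
      fix x assume "x \<in> X"
      then have "x \<in> carrier C" using sub[OF X] by auto
      then show "\<phi> ` (B +>\<^bsub>C\<^esub> r \<odot>\<^bsub>C\<^esub> x) = B' +>\<^bsub>C'\<^esub> R_swap r \<odot>\<^bsub>C'\<^esub> \<phi> x"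
        by (simp add: coset smult_closed smult r)
    qed simp
    then show "\<phi> ` (r \<odot>\<^bsub>?H\<^esub> X) = r \<odot>\<^bsub>S_op ?H'\<^esub> \<phi> ` X"
      by (simp add: S_op_def homology_def Let_def B_def B'_def)
  next
    fix d s
    \<comment> \<open>Taking images commutes with this intersection because \<phi> is
      injective.\<close>
    have "\<phi> ` (Z \<inter> comp C d s) = Z' \<inter> comp C' d (- s)"
      using inj_on_image_Int[OF inj Z_sub comp_closed] by (simp add: \<phi>_Z comp)
    then show "image \<phi> ` comp ?H d s = comp (S_op ?H') d s"
      using image_coset[of "Z \<inter> comp C d s"] Z_sub by (auto simp: comps S_op_def)
  qed
qed

text \<open>The same map serves: \<open>S_op\<close> only replaces \<open>r\<close> by
  \<open>R_swap r\<close>, which is again in the ring, and reindexes the components.\<close>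

lemma S_op_cong:
  assumes "N \<cong>\<^sub>b N'"
  shows "S_op N \<cong>\<^sub>b S_op N'"
proof -
  obtain f where f: "f \<in> iso (add_monoid N) (add_monoid N')"
      "\<And>r x. r \<in> carrier RUV \<Longrightarrow> x \<in> carrier N \<Longrightarrow> f (r \<odot>\<^bsub>N\<^esub> x) = r \<odot>\<^bsub>N'\<^esub> f x"
      "\<And>d s. f ` comp N d s = comp N' d s"
    using assms unfolding bigraded_iso_def by blast
  have "f \<in> iso (add_monoid (S_op N)) (add_monoid (S_op N'))"
    using f(1) by (simp add: S_op_def iso_def hom_def)
  then show ?thesis
    unfolding bigraded_iso_def by (intro bexI[of _ f]) (simp_all add: S_op_def f(2,3))
qed

lemma bigraded_iso_trans [trans]:
  assumes "L \<cong>\<^sub>b M" "M \<cong>\<^sub>b N"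
  shows "L \<cong>\<^sub>b N"
proof -
  obtain f where f: "f \<in> iso (add_monoid L) (add_monoid M)"
      "\<And>r x. r \<in> carrier RUV \<Longrightarrow> x \<in> carrier L \<Longrightarrow> f (r \<odot>\<^bsub>L\<^esub> x) = r \<odot>\<^bsub>M\<^esub> f x"
      "\<And>d s. f ` comp L d s = comp M d s"
    using assms(1) unfolding bigraded_iso_def by blast
  obtain g where g: "g \<in> iso (add_monoid M) (add_monoid N)"
      "\<And>r x. r \<in> carrier RUV \<Longrightarrow> x \<in> carrier M \<Longrightarrow> g (r \<odot>\<^bsub>M\<^esub> x) = r \<odot>\<^bsub>N\<^esub> g x"
      "\<And>d s. g ` comp M d s = comp N d s"
    using assms(2) unfolding bigraded_iso_def by blast
  have carr: "f x \<in> carrier M" if "x \<in> carrier L" for x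
    using f(1) that by (auto simp: iso_def hom_def)
  have "(g \<circ> f) ` comp L d s = comp N d s" for d s
    by (simp only: image_comp[symmetric] f(3) g(3))
  then show ?thesis
    unfolding bigraded_iso_def using iso_set_trans[OF f(1) g(1)]
    by (intro bexI[of _ "g \<circ> f"]) (simp_all add: f(2) g(2) carr)
qed

section \<open>Reversing the orientations of all strands\<close>

text \<open>The matching, the type D structure and the \<Delta>-grading are kept because a
  simultaneous reversal of all strands is seen only by \<open>ups\<close> and the Alexander
  grading.\<close>

definition reversed_level :: "level \<Rightarrow> level" where
  "reversed_level l = l\<lparr>ups := map Not (ups l), grA := (\<lambda>g. - grA l g)\<rparr>"

lemma reversed_level_simps [simp]:
  "matching (reversed_level l) = matching l"
  "ups (reversed_level l) = map Not (ups l)"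
  "struct (reversed_level l) = struct l"
  "grA (reversed_level l) = (\<lambda>g. - grA l g)"
  "gr\<Delta> (reversed_level l) = gr\<Delta> l"
  by (simp_all add: reversed_level_def)

lemma final_coef_closed [simp]: "final_coef l g g' \<in> carrier RUV"
  unfolding final_coef_def by (intro R_swap.R.finsum_closed) auto

text \<open>The direction of strand 1 decides which of the two exponents belongs to
  \<open>U\<close>, so reversal exchanges them in every monomial. At \<open>top_level\<close> the
  sum is empty.\<close>

lemma final_coef_reversed_level:
  assumes "ups l \<noteq> [] \<or> l = top_level"
  shows "final_coef (reversed_level l) g g' = R_swap (final_coef l g g')"
proof (cases "ups l = []")
  case True
  with assms have "l = top_level" by simp
  then show ?thesis by (simp add: final_coef_def top_level_def)
next
  case False
  then show ?thesis
    unfolding final_coef_def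
    by (subst R_swap.hom_finsum; cases "hd (ups l)") (simp_all add: hd_map o_def)
qed

lemma final_diff_closed:
  assumes "f \<in> dgens (struct l) \<rightarrow>\<^sub>E carrier RUV"
  shows "final_diff l f \<in> dgens (struct l) \<rightarrow>\<^sub>E carrier RUV"
  unfolding final_diff_def
  by (rule restrict_PiE_iff[THEN iffD2], intro ballI R_swap.R.finsum_closed)
    (simp add: PiE_mem[OF assms])

lemma final_complex_simps:
  "carrier (final_complex l) = dgens (struct l) \<rightarrow>\<^sub>E carrier RUV"
  "\<zero>\<^bsub>final_complex l\<^esub> = (\<lambda>g \<in> dgens (struct l). \<zero>\<^bsub>RUV\<^esub>)"
  "f \<oplus>\<^bsub>final_complex l\<^esub> h = (\<lambda>g \<in> dgens (struct l). f g \<oplus>\<^bsub>RUV\<^esub> h g)"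
  "r \<odot>\<^bsub>final_complex l\<^esub> f = (\<lambda>g \<in> dgens (struct l). r \<otimes>\<^bsub>RUV\<^esub> f g)"
  "comp (final_complex l) d s = {f \<in> dgens (struct l) \<rightarrow>\<^sub>E carrier RUV.
    \<forall>g \<in> dgens (struct l). f g \<in> R_comp (d - gr\<Delta> l g) (s - grA l g)}"
  by (simp_all add: final_complex_def free_bigraded_def)

lemma final_homology_reversed_level:
  assumes "ups l \<noteq> [] \<or> l = top_level"
  shows "homology (final_complex l) (final_diff l) \<cong>\<^sub>b
    S_op (homology (final_complex (reversed_level l)) (final_diff (reversed_level l)))"
proof -
  let ?G = "dgens (struct l)"
  \<comment> \<open>Coordinatewise exchange of \<open>U\<close> and \<open>V\<close>. Both levels
    have the same generators, so the two complexes have the same carrier and \<phi> is its own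
    inverse.\<close>
  define \<phi> where "\<phi> = (\<lambda>f. \<lambda>g\<in>?G. R_swap (f g))"
  have app_closed: "f g \<in> carrier RUV" if "f \<in> ?G \<rightarrow>\<^sub>E carrier RUV" "g \<in> ?G" for f g
    using that by (rule PiE_mem)
  have \<phi>_app: "\<phi> f g = R_swap (f g)" if "g \<in> ?G" for f g
    using that by (simp add: \<phi>_def)
  have \<phi>_carr: "\<phi> f \<in> ?G \<rightarrow>\<^sub>E carrier RUV" if "f \<in> ?G \<rightarrow>\<^sub>E carrier RUV" for f
    unfolding \<phi>_def by (rule restrict_PiE_iff[THEN iffD2]) (simp add: app_closed that)
  have \<phi>_\<phi>: "\<phi> (\<phi> f) = f" if "f \<in> ?G \<rightarrow>\<^sub>E carrier RUV" for f
    by (rule PiE_ext[OF \<phi>_carr[OF \<phi>_carr[OF that]] that]) (simp add: \<phi>_app)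
  show ?thesis
  proof (rule homology_iso_S_op[where \<phi> = \<phi>])
    show "bij_betw \<phi> (carrier (final_complex l)) (carrier (final_complex (reversed_level l)))"
      unfolding final_complex_simps reversed_level_simps
      by (rule bij_betw_byWitness[where f' = \<phi>]) (use \<phi>_carr \<phi>_\<phi> in blast)+
    show "\<phi> ` comp (final_complex l) d s = comp (final_complex (reversed_level l)) d (- s)" for d s
    proof (rule subset_antisym)
      \<comment> \<open>\<open>R_swap\<close> negates the Alexander degree
        \<open>s - grA l g\<close> of a coordinate. As \<open>grA\<close> is negated too, the result
        is the degree required on the reversed side.\<close>
      show "\<phi> ` comp (final_complex l) d s \<subseteq> comp (final_complex (reversed_level l)) d (- s)"
        by (simp add: final_complex_simps image_subset_iff \<phi>_carr \<phi>_app)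
      show "comp (final_complex (reversed_level l)) d (- s) \<subseteq> \<phi> ` comp (final_complex l) d s"
      proof
        fix f assume f: "f \<in> comp (final_complex (reversed_level l)) d (- s)"
        then have "\<phi> f \<in> comp (final_complex l) d s"
          by (simp add: final_complex_simps \<phi>_carr \<phi>_app)
        moreover have "\<phi> (\<phi> f) = f"
          using f by (simp add: final_complex_simps \<phi>_\<phi>)
        ultimately show "f \<in> \<phi> ` comp (final_complex l) d s" by (metis image_eqI)
      qed
    qed
    show "\<phi> (final_diff l f) = final_diff (reversed_level l) (\<phi> f)"
      if f: "f \<in> carrier (final_complex l)" for f
    proof -
      have fg: "f g \<in> carrier RUV" if "g \<in> ?G" for g
        using f that by (simp add: final_complex_simps app_closed)
      \<comment> \<open>\<open>R_swap\<close> passes through the sum and then through each product,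
        where it turns the coefficients into those of the reversed level.\<close>
      have "R_swap (\<Oplus>\<^bsub>RUV\<^esub>g\<in>?G. f g \<otimes>\<^bsub>RUV\<^esub> final_coef l g g') =
          (\<Oplus>\<^bsub>RUV\<^esub>g\<in>?G. \<phi> f g \<otimes>\<^bsub>RUV\<^esub> final_coef (reversed_level l) g g')" for g'
      proof -
        have "R_swap (\<Oplus>\<^bsub>RUV\<^esub>g\<in>?G. f g \<otimes>\<^bsub>RUV\<^esub> final_coef l g g') =
            (\<Oplus>\<^bsub>RUV\<^esub>g\<in>?G. R_swap (f g \<otimes>\<^bsub>RUV\<^esub> final_coef l g g'))"
          using fg by (subst R_swap.hom_finsum) (simp_all add: o_def)
        also have "\<dots> = (\<Oplus>\<^bsub>RUV\<^esub>g\<in>?G. \<phi> f g \<otimes>\<^bsub>RUV\<^esub> final_coef (reversed_level l) g g')"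
          by (rule R_swap.R.finsum_cong')
            (simp_all add: fg \<phi>_app final_coef_reversed_level[OF assms])
        finally show ?thesis .
      qed
      then show ?thesis
        unfolding final_diff_def reversed_level_simps \<phi>_def
        by (intro restrict_ext) simp
    qed
    show "final_diff l f \<in> carrier (final_complex l)" if "f \<in> carrier (final_complex l)" for f
      using final_diff_closed that by (simp add: final_complex_simps)
    show "\<phi> \<zero>\<^bsub>final_complex l\<^esub> = \<zero>\<^bsub>final_complex (reversed_level l)\<^esub>"
      by (simp add: final_complex_simps \<phi>_def cong: restrict_cong)
    show "\<phi> (f \<oplus>\<^bsub>final_complex l\<^esub> h) = \<phi> f \<oplus>\<^bsub>final_complex (reversed_level l)\<^esub> \<phi> h"
      if "f \<in> carrier (final_complex l)" "h \<in> carrier (final_complex l)" for f h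
      using that by (simp add: final_complex_simps \<phi>_def app_closed cong: restrict_cong)
    show "\<phi> (r \<odot>\<^bsub>final_complex l\<^esub> f) = R_swap r \<odot>\<^bsub>final_complex (reversed_level l)\<^esub> \<phi> f"
      if "r \<in> carrier RUV" "f \<in> carrier (final_complex l)" for r f
      using that by (simp add: final_complex_simps \<phi>_def app_closed cong: restrict_cong)
  qed (auto simp: final_complex_simps app_closed restrict_PiE_iff)
qed

section \<open>Reversal commutes with the construction of the levels\<close>

fun reversed_event :: "event \<Rightarrow> event" where
  "reversed_event (Maximum u c) = Maximum (\<not> u) c"
| "reversed_event (Minimum c) = Minimum c"
| "reversed_event (Crossing pos i) = Crossing pos i"

text \<open>\<open>crossing_sign\<close> only compares the two directions. Reversing both exchanges
  the incoming and outgoing quadrants, whose contributions are opposite.\<close>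

lemma quadrant_A_reversed: "quadrant_A pos (\<not> a) (\<not> b) X = - quadrant_A pos a b X"
  by (cases X) (auto simp: quadrant_A_def crossing_sign_def)

lemma quadrant_\<Delta>_reversed: "quadrant_\<Delta> pos (\<not> a) (\<not> b) X = quadrant_\<Delta> pos a b X"
  by (cases X) (auto simp: quadrant_\<Delta>_def crossing_sign_def)

lemma max_step_reversed: "max_step (\<not> u) c (reversed_level l) = reversed_level (max_step u c l)"
  by (simp add: max_step_def Let_def reversed_level_def take_map drop_map)

text \<open>The bound keeps the positions \<open>i - 1\<close> and \<open>i\<close> within the list,
  where \<open>map Not\<close> commutes with reading entries.\<close>

lemma cross_step_reversed:
  assumes "i < length (ups l)"
  shows "cross_step pos i (reversed_level l) = reversed_level (cross_step pos i l)"
  using assms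
  by (simp add: cross_step_def Let_def reversed_level_def map_update
      quadrant_A_reversed quadrant_\<Delta>_reversed less_imp_diff_less)

lemma length_ups_cross_step [simp]: "length (ups (cross_step pos i l)) = length (ups l)"
  by (simp add: cross_step_def Let_def)

text \<open>For \<open>c > 1\<close> a minimum unfolds into two crossings followed by a minimum
  further left; crossings keep the number of strands, so the bound survives the recursion.\<close>

lemma min_step_reversed:
  "c < length (ups l) \<Longrightarrow> min_step c (reversed_level l) = reversed_level (min_step c l)"
  by (induction c l rule: min_step.induct)
    (simp_all add: cross_step_reversed, simp add: Let_def reversed_level_def drop_map)

text \<open>At most one pair of strands disappears. As \<open>step\<close> performs minima only with
  at least four strands, some strand remains afterwards.\<close>

lemma length_ups_min_step: "length (ups l) - 2 \<le> length (ups (min_step c l))"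
proof (induction c l rule: min_step.induct)
  case (3 c l)
  then show ?case by simp
qed (simp_all add: Let_def)

text \<open>The guards of \<open>step\<close> look only at the number of strands, so both sides take
  the same branch.\<close>

lemma step_reversed: "step (reversed_event e) (reversed_level l) = reversed_level (step e l)"
  by (cases e) (auto simp: max_step_reversed min_step_reversed cross_step_reversed)

lemma fold_step_reversed:
  "fold step (map reversed_event es) (reversed_level l) = reversed_level (fold step es l)"
  by (induction es arbitrary: l) (simp_all add: step_reversed)

text \<open>The strand orientations enter \<^const>\<open>final_coef\<close> through \<^term>\<open>hd (ups l)\<close>, which is
  junk if there are no strands; this happens only for \<^const>\<open>top_level\<close>, whose differential
  vanishes.\<close>

lemma ups_step_nonempty:
  assumes "ups l \<noteq> [] \<or> l = top_level"
  shows "ups (step e l) \<noteq> [] \<or> step e l = top_level"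
proof (cases e)
  case (Maximum u c)
  then show ?thesis using assms by (auto simp: max_step_def Let_def)
next
  case (Minimum c)
  have "ups (min_step c l) \<noteq> []" if "4 \<le> length (ups l)"
    using length_ups_min_step[of l c] that by auto
  then show ?thesis using assms Minimum by auto
next
  case (Crossing pos i)
  have "ups (cross_step pos i l) \<noteq> []" if "i + 1 \<le> length (ups l)"
    using length_ups_cross_step[of pos i l] that by (metis add_is_0 le_zero_eq length_0_conv one_neq_zero)
  then show ?thesis using assms Crossing by auto
qed

lemma ups_fold_step_nonempty:
  "ups l \<noteq> [] \<or> l = top_level \<Longrightarrow> ups (fold step es l) \<noteq> [] \<or> fold step es l = top_level"
  by (induction es arbitrary: l) (simp, metis fold_simps(2) ups_step_nonempty)

text \<open>The top level has no strands and zero gradings, so it is its own reversal; from there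
  reversal is carried through the whole sequence of events.\<close>

lemma HC_reversed:
  assumes "event_sequence D' = map reversed_event (event_sequence D)"
  shows "HC D \<cong>\<^sub>b S_op (HC D')"
proof -
  have "reversed_level top_level = top_level"
    by (simp add: reversed_level_def top_level_def)
  then have "fold step (event_sequence D') top_level =
      reversed_level (fold step (event_sequence D) top_level)"
    using fold_step_reversed[of "event_sequence D" top_level] assms by simp
  then show ?thesis
    using final_homology_reversed_level[OF ups_fold_step_nonempty, of top_level]
    by (simp add: HC_def Let_def)
qed

section \<open>Reversing a diagram\<close>

lemma deriv_reflect:
  fixes f :: "real \<Rightarrow> real"
  assumes "\<And>t. f differentiable (at t)"
  shows "deriv (\<lambda>t. f (- t)) = (\<lambda>t. - deriv f (- t))"
proof
  fix t
  have "DERIV f (- t) :> deriv f (- t)"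
    using assms DERIV_deriv_iff_real_differentiable by blast
  then show "deriv (\<lambda>t. f (- t)) t = - deriv f (- t)"
    by (intro DERIV_imp_deriv) (simp add: DERIV_mirror)
qed

text \<open>Shifting makes the derivative predicates at the two points equal, so
  \<open>deriv\<close> makes the same choice at both.\<close>

lemma deriv_periodic:
  fixes f :: "real \<Rightarrow> real"
  assumes "\<And>t. f (t + c) = f t"
  shows "deriv f (t + c) = deriv f t"
  by (simp add: deriv_def DERIV_shift assms)

lemma reverse_knot_reverse_knot [simp]: "reverse_knot (reverse_knot D) = D"
  by (simp add: reverse_knot_def)

lemma oriented_knot_shift:
  assumes "oriented_knot D" "c \<in> \<int>"
  shows "D (t + c) = D t"
  using assms by (simp add: oriented_knot_def)

lemma oriented_knot_reverse:
  assumes "oriented_knot D"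
  shows "oriented_knot (reverse_knot D)"
proof -
  have smooth: "(deriv ^^ n) (\<lambda>s. D s $ i) differentiable (at t)" for n i t
    using assms by (simp add: oriented_knot_def)
  \<comment> \<open>\<open>oriented_knot\<close> asks for differentiability of all iterated
    derivatives, hence a formula for the n-th one; every derivative contributes a factor
    \<open>- 1\<close>.\<close>
  have iter: "(deriv ^^ n) (\<lambda>s. D (- s) $ i) = (\<lambda>t. (- 1) ^ n * (deriv ^^ n) (\<lambda>s. D s $ i) (- t))"
    for n i
  proof (induction n)
    case (Suc n)
    let ?f = "\<lambda>t. (- 1) ^ n * (deriv ^^ n) (\<lambda>s. D s $ i) t"
    have "(deriv ^^ Suc n) (\<lambda>s. D (- s) $ i) = deriv (\<lambda>t. ?f (- t))"
      by (simp add: Suc)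
    also have "\<dots> = (\<lambda>t. - deriv ?f (- t))"
      by (rule deriv_reflect) (simp add: smooth)
    also have "\<dots> = (\<lambda>t. (- 1) ^ Suc n * (deriv ^^ Suc n) (\<lambda>s. D s $ i) (- t))"
    proof
      fix t
      have "deriv ?f (- t) = (- 1) ^ n * deriv ((deriv ^^ n) (\<lambda>s. D s $ i)) (- t)"
        using smooth by (intro DERIV_imp_deriv DERIV_cmult)
          (simp add: DERIV_deriv_iff_real_differentiable)
      then show "- deriv ?f (- t) = (- 1) ^ Suc n * (deriv ^^ Suc n) (\<lambda>s. D s $ i) (- t)"
        by simp
    qed
    finally show ?case .
  qed simp
  have "(deriv ^^ n) (\<lambda>s. D (- s) $ i) differentiable (at t)" for n i t
  proof -
    have "(deriv ^^ n) (\<lambda>s. D s $ i) \<circ> uminus differentiable (at t)"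
      by (intro differentiable_chain_at smooth) simp
    then show ?thesis unfolding iter by (intro differentiable_mult) (simp_all add: o_def)
  qed
  moreover have "\<exists>i. deriv (\<lambda>s. D (- s) $ i) t \<noteq> 0" for t
    using iter[of 1] assms by (simp add: oriented_knot_def)
  moreover have "D (- s) = D (- t) \<longleftrightarrow> s - t \<in> \<int>" for s t
  proof -
    have "D (- s) = D (- t) \<longleftrightarrow> - (s - t) \<in> \<int>"
      using assms by (simp add: oriented_knot_def)
    then show ?thesis by (simp only: minus_in_Ints_iff)
  qed
  ultimately show ?thesis
    by (simp add: oriented_knot_def reverse_knot_def)
qed

context
  fixes D :: "real \<Rightarrow> real^3"
  assumes D: "oriented_knot D"
begin

lemma coordinate_differentiable:
  "(\<lambda>s. D s $ i) differentiable (at t)" "deriv (\<lambda>s. D s $ i) differentiable (at t)"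
proof -
  have "(deriv ^^ n) (\<lambda>s. D s $ i) differentiable (at t)" for n
    using D by (simp add: oriented_knot_def)
  from this[of 0] this[of 1]
  show "(\<lambda>s. D s $ i) differentiable (at t)" "deriv (\<lambda>s. D s $ i) differentiable (at t)"
    by simp_all
qed

lemma coordinate_shift:
  assumes "c \<in> \<int>"
  shows "D (t + c) $ i = D t $ i" "deriv (\<lambda>s. D s $ i) (t + c) = deriv (\<lambda>s. D s $ i) t"
    "deriv (deriv (\<lambda>s. D s $ i)) (t + c) = deriv (deriv (\<lambda>s. D s $ i)) t"
proof -
  show *: "D (t + c) $ i = D t $ i" for t
    using oriented_knot_shift[OF D assms] by simp
  show **: "deriv (\<lambda>s. D s $ i) (t + c) = deriv (\<lambda>s. D s $ i) t" for t
    by (rule deriv_periodic) (rule *)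
  show "deriv (deriv (\<lambda>s. D s $ i)) (t + c) = deriv (deriv (\<lambda>s. D s $ i)) t"
    by (rule deriv_periodic) (rule **)
qed

text \<open>Allowing any \<open>u\<close> congruent to \<open>- t\<close> modulo 1 covers both the
  literal substitution of \<open>- t\<close> and its reduction to \<open>[0, 1)\<close>.\<close>

lemma coordinate_reverse:
  assumes "u + t \<in> \<int>"
  shows "reverse_knot D u $ i = D t $ i"
    "deriv (\<lambda>s. reverse_knot D s $ i) u = - deriv (\<lambda>s. D s $ i) t"
    "deriv (deriv (\<lambda>s. reverse_knot D s $ i)) u = deriv (deriv (\<lambda>s. D s $ i)) t"
proof -
  have d1: "deriv (\<lambda>s. D (- s) $ i) = (\<lambda>t. - deriv (\<lambda>s. D s $ i) (- t))"
    by (rule deriv_reflect) (rule coordinate_differentiable)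
  have "deriv (\<lambda>t. - deriv (\<lambda>s. D s $ i) (- t)) = (\<lambda>t. - deriv (\<lambda>t. - deriv (\<lambda>s. D s $ i) t) (- t))"
    by (rule deriv_reflect) (simp add: coordinate_differentiable)
  also have "deriv (\<lambda>t. - deriv (\<lambda>s. D s $ i) t) = (\<lambda>t. - deriv (deriv (\<lambda>s. D s $ i)) t)"
    using coordinate_differentiable(2)
    by (intro ext DERIV_imp_deriv DERIV_minus) (simp add: DERIV_deriv_iff_real_differentiable)
  finally have d2: "deriv (deriv (\<lambda>s. D (- s) $ i)) = (\<lambda>t. deriv (deriv (\<lambda>s. D s $ i)) (- t))"
    by (simp add: d1)
  \<comment> \<open>Writing \<open>- u\<close> as \<open>t\<close> plus an integer reduces the
    claims to periodicity.\<close>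
  have u: "- u = t + - (u + t)" and c: "- (u + t) \<in> \<int>"
    using assms minus_in_Ints_iff[of "u + t"] by simp_all
  show "reverse_knot D u $ i = D t $ i"
    unfolding reverse_knot_def u by (rule coordinate_shift[OF c])
  show "deriv (\<lambda>s. reverse_knot D s $ i) u = - deriv (\<lambda>s. D s $ i) t"
    unfolding reverse_knot_def d1 u coordinate_shift[OF c] ..
  show "deriv (deriv (\<lambda>s. reverse_knot D s $ i)) u = deriv (deriv (\<lambda>s. D s $ i)) t"
    unfolding reverse_knot_def d2 u coordinate_shift[OF c] ..
qed

end

lemma knot_reverse:
  assumes "oriented_knot D" "u + t \<in> \<int>"
  shows "knot_x (reverse_knot D) u = knot_x D t" "knot_y (reverse_knot D) u = knot_y D t"
    "knot_z (reverse_knot D) u = knot_z D t"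
    "deriv (knot_x (reverse_knot D)) u = - deriv (knot_x D) t"
    "deriv (knot_y (reverse_knot D)) u = - deriv (knot_y D) t"
    "deriv (deriv (knot_y (reverse_knot D))) u = deriv (deriv (knot_y D)) t"
  using coordinate_reverse[OF assms] by (simp_all add: knot_x_def[abs_def] knot_y_def[abs_def] knot_z_def[abs_def])

text \<open>Parameters are taken in \<open>[0, 1)\<close>, so reversal acts on them as
  \<open>t \<mapsto> frac (- t)\<close>.\<close>

abbreviation reflect :: "real \<Rightarrow> real" where
  "reflect t \<equiv> frac (- t)"

lemma reflect_Ints: "reflect t + t \<in> \<int>"
  by (simp add: frac_def)

lemma reflect_range: "0 \<le> reflect t" "reflect t < 1"
  by (simp_all add: frac_lt_1)

lemma reflect_reflect: "0 \<le> t \<Longrightarrow> t < 1 \<Longrightarrow> reflect (reflect t) = t"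
  by (simp add: frac_neg_frac frac_eq)

lemmas knot_reflect = knot_reverse[OF _ reflect_Ints]

text \<open>Both velocity vectors change sign, and the determinant is bilinear.\<close>

lemma tangent_det_reverse:
  assumes "oriented_knot D" "u + s \<in> \<int>" "v + t \<in> \<int>"
  shows "tangent_det (reverse_knot D) u v = tangent_det D s t"
  by (simp add: tangent_det_def knot_reverse[OF assms(1,2)] knot_reverse[OF assms(1,3)])

section \<open>Events, heights and positions in the reversed diagram\<close>

lemma double_points_reverse:
  assumes "oriented_knot D" "A \<in> double_points D"
  shows "reflect ` A \<in> double_points (reverse_knot D)"
proof -
  obtain s t where st: "A = {s, t}" "s \<in> {0..<1}" "t \<in> {0..<1}" "s \<noteq> t"
      "knot_x D s = knot_x D t" "knot_y D s = knot_y D t"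
    using assms(2) by (auto simp: double_points_def)
  \<comment> \<open>\<open>reflect\<close> is an involution on \<open>[0, 1)\<close>, so distinct
    parameters stay distinct.\<close>
  moreover from this have "reflect s \<noteq> reflect t"
    using reflect_reflect by (metis atLeastLessThan_iff)
  ultimately show ?thesis
    unfolding double_points_def
    by (intro CollectI exI[of _ "reflect s"] exI[of _ "reflect t"])
      (simp add: reflect_range knot_reflect[OF assms(1)])
qed

lemma critical_points_reverse:
  assumes "oriented_knot D" "A \<in> critical_points D"
  shows "reflect ` A \<in> critical_points (reverse_knot D)"
  using assms(2) by (auto simp: critical_points_def reflect_range knot_reflect[OF assms(1)])

lemma events_reverse:
  "oriented_knot D \<Longrightarrow> A \<in> events D \<Longrightarrow> reflect ` A \<in> events (reverse_knot D)"
  using double_points_reverse critical_points_reverse by (auto simp: events_def)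

lemma events_subset: "A \<in> events D \<Longrightarrow> A \<subseteq> {0..<1}"
  by (auto simp: events_def critical_points_def double_points_def)

lemma reflect_image_reflect_image:
  assumes "A \<in> events D"
  shows "reflect ` reflect ` A = A"
proof -
  have "reflect (reflect t) = t" if "t \<in> A" for t
    using events_subset[OF assms] that by (intro reflect_reflect) auto
  then show ?thesis by (simp add: image_image)
qed

lemma event_heights_reverse:
  assumes "oriented_knot D"
  shows "event_heights (reverse_knot D) = event_heights D"
proof -
  \<comment> \<open>Stated for every knot, so that it also applies to the reversed one; reversing
    twice gives \<open>D\<close> back and hence the other inclusion.\<close>
  have sub: "event_heights D \<subseteq> event_heights (reverse_knot D)" if "oriented_knot D" for D
  proof
    fix h assume "h \<in> event_heights D"
    then obtain t A where "A \<in> events D" "t \<in> A" "h = knot_y D t"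
      by (auto simp: event_heights_def)
    then show "h \<in> event_heights (reverse_knot D)"
      unfolding event_heights_def using events_reverse[OF that] knot_reflect(2)[OF that]
      by (intro CollectI exI[of _ "reflect t"] exI[of _ "reflect ` A"]) auto
  qed
  show ?thesis
    using sub[OF assms] sub[OF oriented_knot_reverse[OF assms]] by auto
qed

text \<open>The projected curve is merely traversed backwards, so \<open>reflect\<close> matches the
  parameters of the strands to the left of the event.\<close>

lemma event_position_reverse:
  assumes "oriented_knot D"
  shows "event_position (reverse_knot D) h = event_position D h"
proof -
  define S where "S D = {t \<in> {0..<1}. knot_y D t = h \<and>
     (\<exists>A \<in> events D. \<exists>s \<in> A. knot_y D s = h \<and> knot_x D t < knot_x D s)}" for D
  have sub: "reflect ` S D \<subseteq> S (reverse_knot D)" if D: "oriented_knot D" for D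
  proof
    fix u assume "u \<in> reflect ` S D"
    then obtain t A s where u: "u = reflect t" and t: "knot_y D t = h"
      and A: "A \<in> events D" "s \<in> A" "knot_y D s = h" "knot_x D t < knot_x D s"
      by (auto simp: S_def)
    have "\<exists>B \<in> events (reverse_knot D). \<exists>r \<in> B. knot_y (reverse_knot D) r = h \<and>
        knot_x (reverse_knot D) u < knot_x (reverse_knot D) r"
      using A by (intro bexI[OF _ events_reverse[OF D A(1)]] bexI[of _ "reflect s"])
        (simp_all add: u knot_reflect[OF D])
    then show "u \<in> S (reverse_knot D)"
      by (simp add: S_def u t reflect_range knot_reflect[OF D])
  qed
  have "bij_betw reflect (S (reverse_knot D)) (S D)"
    using sub[OF assms] sub[OF oriented_knot_reverse[OF assms]]
    by (intro bij_betw_byWitness[where f' = reflect]) (simp_all add: S_def reflect_reflect)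
  then show ?thesis
    unfolding event_position_def S_def[symmetric] by (simp add: bij_betw_same_card)
qed

section \<open>Bridge position and isotopy under reversal\<close>

lemma bridge_positionD:
  assumes "bridge_position D"
  shows "deriv (knot_x D) t \<noteq> 0 \<or> deriv (knot_y D) t \<noteq> 0"
    and "{s, t} \<in> double_points D \<Longrightarrow> tangent_det D s t \<noteq> 0"
    and "deriv (knot_y D) t = 0 \<Longrightarrow> deriv (deriv (knot_y D)) t \<noteq> 0"
    and "A \<in> events D \<Longrightarrow> s \<in> A \<Longrightarrow> B \<in> events D \<Longrightarrow> t \<in> B \<Longrightarrow>
      knot_y D s = knot_y D t \<Longrightarrow> A = B"
  using assms unfolding bridge_position_def by blast+

lemma bridge_position_reverse:
  assumes D: "oriented_knot D" and pos: "bridge_position D"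
  shows "bridge_position (reverse_knot D)"
proof -
  have rev: "oriented_knot (reverse_knot D)"
    by (rule oriented_knot_reverse[OF D])
  \<comment> \<open>Unlike \<open>reflect\<close>, the substitution of \<open>- t\<close> reaches
    all real parameters, over which the conditions on derivatives quantify.\<close>
  note neg = knot_reverse[OF D, of t "- t" for t, simplified]
  have immersed: "deriv (knot_x (reverse_knot D)) t \<noteq> 0 \<or> deriv (knot_y (reverse_knot D)) t \<noteq> 0" for t
    using bridge_positionD(1)[OF pos, of "- t"] by (simp add: neg)
  have transverse: "tangent_det (reverse_knot D) s t \<noteq> 0"
    if "{s, t} \<in> double_points (reverse_knot D)" for s t
  proof -
    have "{reflect s, reflect t} \<in> double_points D"
      using double_points_reverse[OF rev that] by simp
    then have "tangent_det D (reflect s) (reflect t) \<noteq> 0"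
      by (rule bridge_positionD(2)[OF pos])
    then show ?thesis
      using tangent_det_reverse[OF D, of s "reflect s" t "reflect t"] reflect_Ints
      by (simp add: add.commute)
  qed
  have nondeg: "deriv (knot_y (reverse_knot D)) t = 0 \<Longrightarrow> deriv (deriv (knot_y (reverse_knot D))) t \<noteq> 0" for t
    using bridge_positionD(3)[OF pos, of "- t"] by (simp add: neg)
  have distinct: "A = B" if A: "A \<in> events (reverse_knot D)" "s \<in> A"
    and B: "B \<in> events (reverse_knot D)" "t \<in> B"
    and eq: "knot_y (reverse_knot D) s = knot_y (reverse_knot D) t" for A B s t
  proof -
    have "reflect ` A \<in> events D" "reflect ` B \<in> events D"
      using events_reverse[OF rev A(1)] events_reverse[OF rev B(1)] by simp_all
    moreover have "knot_y D (reflect s) = knot_y D (reflect t)"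
      using eq knot_reflect(2)[OF rev] by simp
    ultimately have "reflect ` A = reflect ` B"
      using bridge_positionD(4)[OF pos _ imageI[OF A(2)] _ imageI[OF B(2)]] by blast
    \<comment> \<open>Reflecting once more recovers \<open>A\<close> and \<open>B\<close>, since
      events lie in \<open>[0, 1)\<close>.\<close>
    then have "reflect ` reflect ` A = reflect ` reflect ` B" by simp
    then show ?thesis
      using reflect_image_reflect_image A(1) B(1) by simp
  qed
  show ?thesis
    unfolding bridge_position_def using immersed transverse nondeg distinct by blast
qed

text \<open>The ambient isotopy is kept; only the change of parameter is conjugated by negation,
  which leaves it increasing.\<close>

lemma isotopic_knots_reverse:
  assumes "isotopic_knots K L"
  shows "isotopic_knots (reverse_knot K) (reverse_knot L)"
proof -
  obtain H \<theta> where H: "continuous_on ({0..1} \<times> UNIV) H"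
      "\<forall>s \<in> {0..1::real}. \<exists>G. homeomorphism UNIV UNIV (\<lambda>p. H (s, p)) G" "\<forall>p. H (0, p) = p"
    and \<theta>: "continuous_on UNIV \<theta>" "strict_mono \<theta>" "\<forall>t::real. \<theta> (t + 1) = \<theta> t + 1"
    and HK: "\<forall>t. H (1, K t) = L (\<theta> t)"
    using assms unfolding isotopic_knots_def by blast
  have "continuous_on UNIV (\<lambda>t. - \<theta> (- t))"
    by (intro continuous_intros continuous_on_compose2[OF \<theta>(1)]) auto
  moreover have "strict_mono (\<lambda>t. - \<theta> (- t))"
    using \<theta>(2) by (simp add: strict_mono_def)
  moreover have "- \<theta> (- (t + 1)) = - \<theta> (- t) + 1" for t
    using \<theta>(3)[rule_format, of "- t - 1"] by simp
  ultimately show ?thesis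
    unfolding isotopic_knots_def using H HK
    by (intro exI[of _ H] exI[of _ "\<lambda>t. - \<theta> (- t)"]) (simp add: reverse_knot_def)
qed

lemma bridge_diagram_reverse:
  "bridge_diagram K D \<Longrightarrow> bridge_diagram (reverse_knot K) (reverse_knot D)"
  by (simp add: bridge_diagram_def oriented_knot_reverse bridge_position_reverse
      isotopic_knots_reverse)

text \<open>The kind of an event depends on the zeros of \<open>y'\<close> and the sign of
  \<open>y''\<close>, which persist. At a maximum \<open>x'\<close> changes sign, so the flag flips;
  at a crossing the sign changes of the two factors \<open>y'\<close> cancel.\<close>

lemma event_at_reverse:
  assumes D: "oriented_knot D" and pos: "bridge_position D"
  shows "event_at (reverse_knot D) h = reversed_event (event_at D h)"
proof -
  let ?R = "reverse_knot D"
  have rev: "oriented_knot ?R"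
    by (rule oriented_knot_reverse[OF D])
  note neg = knot_reverse[OF D, of t "- t" for t, simplified]
  have ex_minus: "(\<exists>t. P (- t)) \<longleftrightarrow> (\<exists>t. P t)" for P :: "real \<Rightarrow> bool"
    by (metis minus_minus)
  have max_iff: "(\<exists>t. knot_y ?R t = h \<and> deriv (knot_y ?R) t = 0 \<and> deriv (deriv (knot_y ?R)) t < 0) \<longleftrightarrow>
      (\<exists>t. knot_y D t = h \<and> deriv (knot_y D) t = 0 \<and> deriv (deriv (knot_y D)) t < 0)"
    unfolding neg neg_equal_0_iff_equal
    by (rule ex_minus[of "\<lambda>t. knot_y D t = h \<and> deriv (knot_y D) t = 0 \<and> deriv (deriv (knot_y D)) t < 0"])
  have crit_iff: "(\<exists>t. knot_y ?R t = h \<and> deriv (knot_y ?R) t = 0) \<longleftrightarrow>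
      (\<exists>t. knot_y D t = h \<and> deriv (knot_y D) t = 0)"
    unfolding neg neg_equal_0_iff_equal
    by (rule ex_minus[of "\<lambda>t. knot_y D t = h \<and> deriv (knot_y D) t = 0"])
  \<comment> \<open>There is only one critical point at height \<open>h\<close>, and \<open>x' \<noteq> 0\<close> there, so the flag is the
    sign of \<open>x'\<close>.\<close>
  have flag: "(\<exists>t. knot_y ?R t = h \<and> deriv (knot_y ?R) t = 0 \<and> deriv (knot_x ?R) t > 0) \<longleftrightarrow>
      \<not> (\<exists>t. knot_y D t = h \<and> deriv (knot_y D) t = 0 \<and> deriv (knot_x D) t > 0)"
    if crit: "\<exists>t. knot_y D t = h \<and> deriv (knot_y D) t = 0"
  proof -
    obtain t0 where t0: "knot_y D t0 = h" "deriv (knot_y D) t0 = 0" using crit by blast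
    have x0: "deriv (knot_x D) t0 \<noteq> 0"
      using bridge_positionD(1)[OF pos, of t0] t0 by simp
    have unique: "deriv (knot_x D) t = deriv (knot_x D) t0"
      if t: "knot_y D t = h" "deriv (knot_y D) t = 0" for t
    proof -
      \<comment> \<open>Critical points are recorded by parameters in \<open>[0, 1)\<close>, so the
        uniqueness from bridge position is applied to \<open>frac t\<close> and
        \<open>frac t0\<close>.\<close>
      have shift: "knot_y D (frac t) = knot_y D t" "deriv (knot_y D) (frac t) = deriv (knot_y D) t"
        "deriv (knot_x D) (frac t) = deriv (knot_x D) t" for t
        using coordinate_shift[OF D, where c = "- of_int \<lfloor>t\<rfloor>" and t = t]
        by (simp_all add: frac_def knot_x_def[abs_def] knot_y_def[abs_def])
      have "{frac t} \<in> events D" "{frac t0} \<in> events D"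
        by (simp_all add: events_def critical_points_def shift frac_lt_1 t t0)
      moreover have "knot_y D (frac t) = knot_y D (frac t0)"
        using t t0 by (simp add: shift)
      ultimately have "{frac t} = {frac t0}"
        using bridge_positionD(4)[OF pos _ singletonI _ singletonI] by blast
      then have "frac t = frac t0" by simp
      then show ?thesis using shift(3)[of t] shift(3)[of t0] by simp
    qed
    have at_t0: "(\<exists>t. knot_y D t = h \<and> deriv (knot_y D) t = 0 \<and> P (deriv (knot_x D) t)) \<longleftrightarrow>
        P (deriv (knot_x D) t0)" for P
    proof
      assume "\<exists>t. knot_y D t = h \<and> deriv (knot_y D) t = 0 \<and> P (deriv (knot_x D) t)"
      then obtain t where "knot_y D t = h" "deriv (knot_y D) t = 0" "P (deriv (knot_x D) t)"
        by blast
      then show "P (deriv (knot_x D) t0)" using unique[of t] by simp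
    qed (use t0 in blast)
    have "(\<exists>t. knot_y ?R t = h \<and> deriv (knot_y ?R) t = 0 \<and> deriv (knot_x ?R) t > 0) \<longleftrightarrow>
        (\<exists>t. knot_y D t = h \<and> deriv (knot_y D) t = 0 \<and> - deriv (knot_x D) t > 0)"
      unfolding neg neg_equal_0_iff_equal
      by (rule ex_minus[of "\<lambda>t. knot_y D t = h \<and> deriv (knot_y D) t = 0 \<and> - deriv (knot_x D) t > 0"])
    also have "\<dots> \<longleftrightarrow> - deriv (knot_x D) t0 > 0"
      by (rule at_t0)
    \<comment> \<open>Here \<open>x0\<close> matters: a zero derivative would make both flags
      false.\<close>
    also have "\<dots> \<longleftrightarrow> \<not> deriv (knot_x D) t0 > 0"
      using x0 by linarith
    finally show ?thesis
      unfolding at_t0[of "\<lambda>x. x > 0"] .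
  qed
  \<comment> \<open>One implication for an arbitrary knot; applying it to \<open>D\<close> and to
    its reversal gives the equivalence.\<close>
  have sign: "\<exists>s t. {s, t} \<in> double_points (reverse_knot D) \<and> knot_y (reverse_knot D) s = h \<and>
      knot_z (reverse_knot D) s > knot_z (reverse_knot D) t \<and>
      tangent_det (reverse_knot D) s t * deriv (knot_y (reverse_knot D)) s *
        deriv (knot_y (reverse_knot D)) t > 0"
    if D: "oriented_knot D" and ex: "\<exists>s t. {s, t} \<in> double_points D \<and> knot_y D s = h \<and>
      knot_z D s > knot_z D t \<and>
      tangent_det D s t * deriv (knot_y D) s * deriv (knot_y D) t > 0" for D
  proof -
    obtain s t where st: "{s, t} \<in> double_points D" "knot_y D s = h" "knot_z D s > knot_z D t"
        "tangent_det D s t * deriv (knot_y D) s * deriv (knot_y D) t > 0"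
      using ex by blast
    then show ?thesis
      using double_points_reverse[OF D st(1)]
      by (intro exI[of _ "reflect s"] exI[of _ "reflect t"])
        (simp add: knot_reflect[OF D] tangent_det_reverse[OF D reflect_Ints reflect_Ints])
  qed
  have sign_iff: "(\<exists>s t. {s, t} \<in> double_points ?R \<and> knot_y ?R s = h \<and> knot_z ?R s > knot_z ?R t \<and>
        tangent_det ?R s t * deriv (knot_y ?R) s * deriv (knot_y ?R) t > 0) \<longleftrightarrow>
      (\<exists>s t. {s, t} \<in> double_points D \<and> knot_y D s = h \<and> knot_z D s > knot_z D t \<and>
        tangent_det D s t * deriv (knot_y D) s * deriv (knot_y D) t > 0)"
    using sign[OF D] sign[OF rev] unfolding reverse_knot_reverse_knot by (rule iffI[rotated])
  show ?thesis
  proof (cases "\<exists>t. knot_y D t = h \<and> deriv (knot_y D) t = 0")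
    case True
    show ?thesis
      unfolding event_at_def max_iff crit_iff flag[OF True] event_position_reverse[OF D]
      by (simp only: True if_True if_distrib[of reversed_event] reversed_event.simps)
  next
    case False
    then have "\<not> (\<exists>t. knot_y D t = h \<and> deriv (knot_y D) t = 0 \<and> deriv (deriv (knot_y D)) t < 0)"
      by blast
    with False show ?thesis
      unfolding event_at_def max_iff crit_iff sign_iff event_position_reverse[OF D]
      by (simp only: if_False reversed_event.simps)
  qed
qed

text \<open>Both diagrams list the same heights in the same order, so \<open>butlast\<close> drops
  the same height from both.\<close>

lemma event_sequence_reverse:
  assumes "oriented_knot D" "bridge_position D"
  shows "event_sequence (reverse_knot D) = map reversed_event (event_sequence D)"
proof -
  have "event_at (reverse_knot D) = reversed_event \<circ> event_at D"
    by (rule ext) (simp add: event_at_reverse[OF assms])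
  then show ?thesis
    unfolding event_sequence_def event_heights_reverse[OF assms(1)] map_butlast map_map
    by (simp only:)
qed

section \<open>Comparison of the invariants\<close>

lemma HC_reverse:
  assumes "bridge_diagram K D"
  shows "HC D \<cong>\<^sub>b S_op (HC (reverse_knot D))"
  using assms by (intro HC_reversed event_sequence_reverse) (simp_all add: bridge_diagram_def)

text \<open>As \<open>J\<close> collects the modules of all bridge diagrams, reversing diagrams
  matches the two collections in both directions; the last part passes to arbitrary representatives
  by invariance for the reversed knot.\<close>

theorem proposition1p1:
  fixes K :: "real \<Rightarrow> real^3"
  assumes "oriented_knot K"
  shows "(\<forall>M \<in> J K. \<exists>N \<in> J (reverse_knot K). M \<cong>\<^sub>b S_op N) \<and>
         (\<forall>N \<in> J (reverse_knot K). \<exists>M \<in> J K. M \<cong>\<^sub>b S_op N) \<and>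
         ((\<forall>N \<in> J (reverse_knot K). \<forall>N' \<in> J (reverse_knot K). N \<cong>\<^sub>b N') \<longrightarrow>
            (\<forall>M \<in> J K. \<forall>N \<in> J (reverse_knot K). M \<cong>\<^sub>b S_op N))"
proof (intro conjI impI ballI)
  have J_I: "HC D \<in> J L" if "bridge_diagram L D" for L D
    using that unfolding J_def by blast
  show partner: "\<exists>N \<in> J (reverse_knot K). M \<cong>\<^sub>b S_op N" if "M \<in> J K" for M
  proof -
    obtain D where D: "bridge_diagram K D" "M = HC D"
      using \<open>M \<in> J K\<close> unfolding J_def by blast
    show ?thesis
      unfolding D(2) using HC_reverse[OF D(1)] J_I[OF bridge_diagram_reverse[OF D(1)]] by (rule bexI)
  qed
  show "\<exists>M \<in> J K. M \<cong>\<^sub>b S_op N" if "N \<in> J (reverse_knot K)" for N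
  proof -
    obtain D where D: "bridge_diagram (reverse_knot K) D" "N = HC D"
      using \<open>N \<in> J (reverse_knot K)\<close> unfolding J_def by blast
    \<comment> \<open>Reversal is an involution, so a diagram of the reversed knot comes from one of
      \<open>K\<close>.\<close>
    have D': "bridge_diagram K (reverse_knot D)"
      using bridge_diagram_reverse[OF D(1)] unfolding reverse_knot_reverse_knot .
    show ?thesis
      unfolding D(2)
      using HC_reverse[OF D', unfolded reverse_knot_reverse_knot] J_I[OF D'] by (rule bexI)
  qed
  show "M \<cong>\<^sub>b S_op N"
    if inv: "\<forall>N \<in> J (reverse_knot K). \<forall>N' \<in> J (reverse_knot K). N \<cong>\<^sub>b N'"
      and M: "M \<in> J K" and N: "N \<in> J (reverse_knot K)" for M N
  proof -
    \<comment> \<open>\<open>N'\<close> is a partner of \<open>M\<close> obtained by reversing a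
      diagram; the assumed invariance then replaces it by the given \<open>N\<close>.\<close>
    obtain N' where N': "N' \<in> J (reverse_knot K)" "M \<cong>\<^sub>b S_op N'"
      using partner[OF M] by blast
    have "S_op N' \<cong>\<^sub>b S_op N"
      using inv N'(1) N by (intro S_op_cong) blast
    with N'(2) show ?thesis by (rule bigraded_iso_trans)
  qed
qed

end
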